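(* The following conditions are equivalent: (1) $\mathfrak{b}=\omega_1$; (2) there is an almost disjoint family $\mathcal{A}=\{A_\xi:\xi<\omega_1\}$ of subsets of $\mathbb{N}$ such that there is no (linear) isometric embedding $S:\ell_\infty^c(\omega_1)\to C(\mathbb{N}^* )$ satisfying $S(1_{\{\xi\}})=1_{[A_\xi]}$ for every $\xi<\omega_1$.
   Context: All Banach spaces are over $\mathbb{R}$. $\mathfrak{b}$ is the minimal cardinality of a family of functions in $\mathbb{N}^{\mathbb{N}}$ which is unbounded in the order of eventual pointwise domination. An almost disjoint family is an infinite family of infinite subsets of $\mathbb{N}$ any two distinct members of which have finite intersection; an indexed family $\{A_\xi:\xi<\kappa\}$ is enumerated without repetitions. $\ell_\infty^c(\kappa)$ is the subspace of $\ell_\infty(\kappa)$ (supremum norm) consisting of the elements with countable support. $1_A$ is the characteristic function of $A$. $\mathbb{N}^*=\beta\mathbb{N}\setminus\mathbb{N}$, identified with the Stone space of the Boolean algebra $\wp(\mathbb{N})/Fin$ ($Fin$ the ideal of finite sets); for $A\subseteq\mathbb{N}$, $[A]$ is the class of $A$ in $\wp(\mathbb{N})/Fin$, identified with the corresponding clopen subset of $\mathbb{N}^*$. $C(\mathbb{N}^* )$ is the Banach space of continuous real functions on $\mathbb{N}^*$ with the supremum norm; it is canonically isometric to $\ell_\infty/c_0$ via an isometry sending the class $[1_A]$ to $1_{[A]}$. *)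

theory Defs
  imports "HOL-Analysis.Analysis" "HOL-Probability.Discrete_Topology"
begin

unbundle cardinal_syntax

section \<open>Cardinals\<close>

definition eventually_dominated :: "(nat \<Rightarrow> nat) \<Rightarrow> (nat \<Rightarrow> nat) \<Rightarrow> bool" (infix "\<le>*" 50)
  where "f \<le>* g \<longleftrightarrow> eventually (\<lambda>n. f n \<le> g n) sequentially"

definition unbounded_family :: "(nat \<Rightarrow> nat) set \<Rightarrow> bool"
  where "unbounded_family F \<longleftrightarrow> \<not> (\<exists>g. \<forall>f\<in>F. f \<le>* g)"

text \<open>Cardinals are represented by order relations, as in the library, and are unique only up
  to \<open>=o\<close>. An unbounded family of least cardinality exists because cardinals are well-ordered.\<close>

definition bounding_number :: "(nat \<Rightarrow> nat) rel"
  where "bounding_number =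
    |SOME F. unbounded_family F \<and> (\<forall>G. unbounded_family G \<longrightarrow> |F| \<le>o |G| )|"

text \<open>\<open>cardSuc natLeq\<close> is a well-order of type \<open>\<omega>\<^sub>1\<close>; the type below consists of
  its elements, that is, of the ordinals below \<open>\<omega>\<^sub>1\<close>.\<close>

typedef omega1 = "Field (cardSuc natLeq)"
proof -
  have "infinite (Field (cardSuc natLeq))"
    using Cinfinite_cardSuc[OF natLeq_Cinfinite] by (simp add: cinfinite_def)
  then show ?thesis
    using infinite_imp_nonempty by blast
qed


section \<open>Almost disjoint families\<close>

definition almost_disjoint_family :: "nat set set \<Rightarrow> bool"
  where "almost_disjoint_family \<A> \<longleftrightarrow>
    infinite \<A> \<and> (\<forall>A\<in>\<A>. infinite A) \<and> (\<forall>A\<in>\<A>. \<forall>B\<in>\<A>. A \<noteq> B \<longrightarrow> finite (A \<inter> B))"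


section \<open>The space \<open>\<nat>\<^sup>* = \<beta>\<nat> - \<nat>\<close> and its clopen sets\<close>

text \<open>Ultrafilters of the Boolean algebra \<open>\<wp>(\<nat>)/Fin\<close> are the ultrafilters on \<open>\<nat>\<close> that
  contain all cofinite sets.\<close>

typedef nstar =
  "{p :: nat filter. p \<noteq> bot \<and> p \<le> cofinite \<and>
     (\<forall>P. eventually P p \<or> eventually (\<lambda>n. \<not> P n) p)}"
  morphisms filter_of nstar_of
proof -
  have nbot: "cofinite \<noteq> (bot :: nat filter)"
    by (simp add: cofinite_bot)
  let ?A = "{F :: nat filter. F \<noteq> bot \<and> F \<le> cofinite}"
  have "\<exists>m\<in>?A. \<forall>a\<in>?A. a \<le> m \<longrightarrow> a = m"
  proof (rule predicate_Zorn)
    show "partial_order_on ?A (relation_of (\<lambda>F G. G \<le> F) ?A)"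
      by (rule partial_order_on_relation_ofI) auto
  next
    fix C assume C: "C \<in> Chains (relation_of (\<lambda>F G. G \<le> F) ?A)"
    let ?D = "insert cofinite C"
    have CA: "C \<subseteq> ?A"
      using C by (auto simp: Chains_def relation_of_def)
    have "eventually P (Inf ?D) \<longleftrightarrow> (\<exists>b\<in>?D. eventually P b)" for P
    proof (rule eventually_Inf_base)
      fix F G assume "F \<in> ?D" "G \<in> ?D"
      then have "F \<le> G \<or> G \<le> F"
        using C CA by (auto simp: Chains_def relation_of_def)
      then show "\<exists>x\<in>?D. x \<le> inf F G"
        using \<open>F \<in> ?D\<close> \<open>G \<in> ?D\<close> by (elim disjE) (auto simp: inf_absorb1 inf_absorb2)
    qed simp
    moreover have "b \<noteq> bot" if "b \<in> ?D" for b
      using that subsetD[OF CA, of b] nbot by (elim insertE) simp_all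
    ultimately have "Inf ?D \<noteq> bot"
      unfolding trivial_limit_def by blast
    then have "Inf ?D \<in> ?A"
      by (auto intro: Inf_lower)
    moreover have "\<forall>a\<in>C. Inf ?D \<le> a"
      by (auto intro: le_infI2 Inf_lower)
    ultimately show "\<exists>u\<in>?A. \<forall>a\<in>C. u \<le> a"
      by blast
  qed
  then obtain m where mA: "m \<in> ?A" and mmax: "\<forall>a\<in>?A. a \<le> m \<longrightarrow> a = m" ..
  from mA have m: "m \<noteq> bot" "m \<le> cofinite"
    by simp_all
  from mmax have max: "a = m" if "a \<noteq> bot" "a \<le> cofinite" "a \<le> m" for a
    using that by simp
  have "eventually P m \<or> eventually (\<lambda>n. \<not> P n) m" for P
  proof (cases "inf m (principal {n. P n}) = bot")
    case True
    then show ?thesis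
      by (simp add: trivial_limit_def eventually_inf_principal)
  next
    case False
    then have "inf m (principal {n. P n}) = m"
      using m by (intro max) (auto intro: le_infI1)
    moreover have "eventually P (inf m (principal {n. P n}))"
      by (simp add: eventually_inf_principal)
    ultimately show ?thesis
      by simp
  qed
  with m show ?thesis
    by blast
qed

text \<open>The clopen set \<open>[A]\<close>, that is, the set of all ultrafilters in \<open>\<nat>\<^sup>*\<close> containing \<open>A\<close>.\<close>

definition clopen_of :: "nat set \<Rightarrow> nstar set"
  where "clopen_of A = {p. eventually (\<lambda>n. n \<in> A) (filter_of p)}"

instantiation nstar :: topological_space
begin

definition open_nstar :: "nstar set \<Rightarrow> bool"
  where "open_nstar = generate_topology (range clopen_of)"

instance
  by intro_classes (auto simp: open_nstar_def intro: generate_topology.intros)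

end

lemma Compl_clopen_of: "- clopen_of A = clopen_of (- A)"
proof -
  have "eventually (\<lambda>n. n \<notin> A) (filter_of p) \<longleftrightarrow> \<not> eventually (\<lambda>n. n \<in> A) (filter_of p)" for p
  proof -
    have "filter_of p \<noteq> bot"
      "eventually (\<lambda>n. n \<in> A) (filter_of p) \<or> eventually (\<lambda>n. n \<notin> A) (filter_of p)"
      using filter_of[of p] by auto
    then show ?thesis
      using eventually_conj[of "\<lambda>n. n \<in> A" "filter_of p" "\<lambda>n. n \<notin> A"]
      by (auto simp: trivial_limit_def)
  qed
  then show ?thesis
    by (auto simp: clopen_of_def)
qed

lemma open_clopen_of: "open (clopen_of A)"
  by (simp add: open_nstar_def generate_topology.Basis)

lemma closed_clopen_of: "closed (clopen_of A)"
  by (simp add: closed_def Compl_clopen_of open_clopen_of)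


section \<open>Banach spaces\<close>

text \<open>Since \<open>\<nat>\<^sup>*\<close> is compact, \<open>C(\<nat>\<^sup>*)\<close> is its space of bounded continuous functions.\<close>

type_synonym C_nstar = "nstar \<Rightarrow>\<^sub>C real"

definition char_clopen :: "nat set \<Rightarrow> C_nstar"
  where "char_clopen A = Bcontfun (indicator (clopen_of A))"

lemma apply_char_clopen: "apply_bcontfun (char_clopen A) = indicator (clopen_of A)"
proof -
  have "continuous_on UNIV (indicator (clopen_of A) :: nstar \<Rightarrow> real)"
    unfolding continuous_on_open_vimage[OF open_UNIV]
  proof (intro allI impI)
    fix B :: "real set"
    have "indicator (clopen_of A) -` B \<inter> UNIV \<in> {{}, UNIV, clopen_of A, - clopen_of A}"
      by (cases "0 \<in> B"; cases "1 \<in> B") (auto simp: indicator_def of_bool_def split: if_splits)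
    then show "open (indicator (clopen_of A) -` B \<inter> UNIV)"
      using open_clopen_of[of A] open_clopen_of[of "- A"] by (auto simp: Compl_clopen_of)
  qed
  moreover have "bounded (range (indicator (clopen_of A) :: nstar \<Rightarrow> real))"
    by (rule bounded_subset[of "{0, 1}"]) (auto simp: indicator_def)
  ultimately show ?thesis
    by (simp add: char_clopen_def Bcontfun_inverse bcontfun_def)
qed

text \<open>All functions on a discrete space are continuous, so this is \<open>\<ell>\<^sub>\<infinity>(\<kappa>)\<close> for the index
  set \<open>\<kappa> = UNIV\<close> of the given type.\<close>

type_synonym 'k linf = "'k discrete \<Rightarrow>\<^sub>C real"

definition linf_c :: "'k linf set"
  where "linf_c = {x. countable {i. apply_bcontfun x i \<noteq> 0}}"

definition char_singleton :: "'k \<Rightarrow> 'k linf"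
  where "char_singleton i = Bcontfun (indicator {discrete i})"

lemma apply_char_singleton:
  fixes i :: 'k
  shows "apply_bcontfun (char_singleton i) = indicator {discrete i}"
proof -
  have "continuous_on UNIV (indicator {discrete i} :: 'k discrete \<Rightarrow> real)"
    by (simp add: continuous_on_open_vimage open_discrete)
  moreover have "bounded (range (indicator {discrete i} :: 'k discrete \<Rightarrow> real))"
    by (rule bounded_subset[of "{0, 1}"]) (auto simp: indicator_def)
  ultimately show ?thesis
    by (simp add: char_singleton_def Bcontfun_inverse bcontfun_def)
qed

text \<open>Isometric embeddings of a linear subspace \<open>X\<close>; the values of \<open>S\<close> outside \<open>X\<close> are irrelevant.\<close>

definition isometric_embedding_on ::
  "'a::real_normed_vector set \<Rightarrow> ('a \<Rightarrow> 'b::real_normed_vector) \<Rightarrow> bool"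
  where "isometric_embedding_on X S \<longleftrightarrow>
    (\<forall>x\<in>X. \<forall>y\<in>X. S (x + y) = S x + S y) \<and>
    (\<forall>c. \<forall>x\<in>X. S (c *\<^sub>R x) = c *\<^sub>R S x) \<and>
    (\<forall>x\<in>X. norm (S x) = norm x)"

end

(*
If b = omega_1, take an unbounded family F of omega_1 functions and consider the columns of
nat x nat together with the graphs of the functions n |-> code(f|n), f in F. An isometry S with
S(1_{xi}) = 1_{[A_xi]} sends each x of norm at most 1 with x(xi) = 0 to a function vanishing on
[A_xi], because S(x) + 1_{[A_xi]} and S(x) - 1_{[A_xi]} have norm at most 1. Hence the image of
the characteristic function of the (countably many) column indices separates the columns from the
graphs, and a set separating them yields a function that dominates F.

If b > omega_1, recursion on alpha < omega_1 yields partial functions p_alpha from nat to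
{xi. xi <= alpha} with fibres almost equal to the sets A_xi, such that for alpha < beta the
restriction of p_beta to values <= alpha agrees with p_alpha at almost all points. So x o p_alpha
(extended by 0) does not depend, modulo finite sets, on the bound alpha of the support of x, and
its class is the required image of x.
*)
theory Submission
  imports Defs
begin

section \<open>Ultrafilters and the topology of \<open>\<nat>\<^sup>*\<close>\<close>

text \<open>Zorn's lemma gives a minimal proper filter below \<open>F\<close>. It decides every
  \<open>P\<close>, because its meet with \<open>principal {x. P x}\<close> is either
  \<open>bot\<close> or, by minimality, the filter itself.\<close>

lemma finer_ultrafilter_exists:
  fixes F :: "'a filter"
  assumes "F \<noteq> bot"
  obtains G where "G \<noteq> bot" "G \<le> F" "\<And>P. eventually P G \<or> eventually (\<lambda>x. \<not> P x) G"
proof -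
  let ?A = "{G :: 'a filter. G \<noteq> bot \<and> G \<le> F}"
  have "\<exists>m\<in>?A. \<forall>a\<in>?A. a \<le> m \<longrightarrow> a = m"
  proof (rule predicate_Zorn)
    show "partial_order_on ?A (relation_of (\<lambda>F G. G \<le> F) ?A)"
      by (rule partial_order_on_relation_ofI) auto
  next
    fix C assume C: "C \<in> Chains (relation_of (\<lambda>F G. G \<le> F) ?A)"
    \<comment> \<open>Adding \<open>F\<close> keeps the family nonempty when the chain is empty, and
      keeps its infimum below \<open>F\<close>.\<close>
    let ?D = "insert F C"
    have CA: "C \<subseteq> ?A"
      using C by (auto simp: Chains_def relation_of_def)
    have "eventually P (Inf ?D) \<longleftrightarrow> (\<exists>b\<in>?D. eventually P b)" for P
    proof (rule eventually_Inf_base)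
      fix G H assume "G \<in> ?D" "H \<in> ?D"
      then have "G \<le> H \<or> H \<le> G"
        using C CA by (auto simp: Chains_def relation_of_def)
      then show "\<exists>x\<in>?D. x \<le> inf G H"
        using \<open>G \<in> ?D\<close> \<open>H \<in> ?D\<close> by (elim disjE) (auto simp: inf_absorb1 inf_absorb2)
    qed simp
    moreover have "b \<noteq> bot" if "b \<in> ?D" for b
      using that subsetD[OF CA, of b] assms by (elim insertE) simp_all
    ultimately have "Inf ?D \<noteq> bot"
      unfolding trivial_limit_def by blast
    then have "Inf ?D \<in> ?A"
      by (auto intro: Inf_lower)
    moreover have "\<forall>a\<in>C. Inf ?D \<le> a"
      by (auto intro: le_infI2 Inf_lower)
    ultimately show "\<exists>u\<in>?A. \<forall>a\<in>C. u \<le> a"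
      by blast
  qed
  then obtain m where "m \<in> ?A" and max: "\<forall>a\<in>?A. a \<le> m \<longrightarrow> a = m" ..
  then have m: "m \<noteq> bot" "m \<le> F"
    by simp_all
  have "eventually P m \<or> eventually (\<lambda>x. \<not> P x) m" for P
  proof (cases "inf m (principal {x. P x}) = bot")
    case True
    then show ?thesis
      by (simp add: trivial_limit_def eventually_inf_principal)
  next
    case False
    moreover have "inf m (principal {x. P x}) \<le> F"
      using m by (auto intro: le_infI1)
    ultimately have "inf m (principal {x. P x}) = m"
      using max by simp
    moreover have "eventually P (inf m (principal {x. P x}))"
      by (simp add: eventually_inf_principal)
    ultimately show ?thesis
      by simp
  qed
  with m that show ?thesis
    by blast
qed

lemma filter_of_neq_bot [simp]: "filter_of p \<noteq> bot"
  and filter_of_le_cofinite: "filter_of p \<le> cofinite"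
  and filter_of_cases: "eventually P (filter_of p) \<or> eventually (\<lambda>n. \<not> P n) (filter_of p)"
  using filter_of[of p] by auto

lemma eventually_filter_of_if_sequentially:
  "eventually P sequentially \<Longrightarrow> eventually P (filter_of p)"
  using filter_of_le_cofinite[of p] by (simp add: cofinite_eq_sequentially filter_leD)

lemma nstar_below_filter:
  fixes F :: "nat filter"
  assumes "F \<noteq> bot" "F \<le> cofinite"
  obtains p where "filter_of p \<le> F"
proof -
  obtain G where G: "G \<noteq> bot" "G \<le> F" "\<And>P. eventually P G \<or> eventually (\<lambda>x. \<not> P x) G"
    using assms(1) by (rule finer_ultrafilter_exists) blast
  then have "filter_of (nstar_of G) = G"
    using assms(2) by (intro nstar_of_inverse) auto
  with G have "filter_of (nstar_of G) \<le> F"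
    by simp
  then show ?thesis ..
qed

lemma clopen_of_nonempty:
  assumes "infinite A"
  obtains p where "p \<in> clopen_of A"
proof -
  have "inf cofinite (principal A) \<noteq> bot"
    using assms by (simp add: trivial_limit_def eventually_inf_principal eventually_cofinite)
  then obtain p where "filter_of p \<le> inf cofinite (principal A)"
    by (rule nstar_below_filter) auto
  then have "filter_of p \<le> principal A"
    by simp
  then have "p \<in> clopen_of A"
    by (simp add: clopen_of_def le_principal)
  then show ?thesis ..
qed

lemma clopen_of_Int: "clopen_of (A \<inter> B) = clopen_of A \<inter> clopen_of B"
  by (auto simp: clopen_of_def eventually_conj_iff)

lemma clopen_of_UNIV: "clopen_of UNIV = UNIV"
  by (simp add: clopen_of_def)

lemma clopen_of_Un: "clopen_of (A \<union> B) = clopen_of A \<union> clopen_of B"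
proof -
  have "- clopen_of (A \<union> B) = - (clopen_of A \<union> clopen_of B)"
    by (simp only: Compl_clopen_of Compl_Un clopen_of_Int)
  then show ?thesis
    by (simp only: Compl_eq_Compl_iff)
qed

lemma clopen_of_UNION:
  "finite I \<Longrightarrow> clopen_of (\<Union>i\<in>I. A i) = (\<Union>i\<in>I. clopen_of (A i))"
proof (induction rule: finite_induct)
  case empty
  then show ?case
    using Compl_clopen_of[of UNIV] by (simp add: clopen_of_UNIV)
qed (simp add: clopen_of_Un)

text \<open>An infinite \<open>A - B\<close> would belong to some point of [A] outside [B].
  Inclusions between clopen sets are thus read back as inclusions modulo finite sets.\<close>

lemma finite_diff_if_clopen_of_subset:
  assumes "clopen_of A \<subseteq> clopen_of B"
  shows "finite (A - B)"
proof (rule ccontr)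
  assume "infinite (A - B)"
  then obtain p where "p \<in> clopen_of (A - B)"
    by (rule clopen_of_nonempty)
  then show False
    using assms Compl_clopen_of[of B] by (auto simp: Diff_eq clopen_of_Int)
qed

section \<open>Base, compactness and clopen separation\<close>

text \<open>The sets \<open>clopen_of A\<close> are given only as a subbase; closure under finite
  intersections makes them a base.\<close>

lemma open_nstarE:
  assumes "open U" "p \<in> U"
  obtains A where "p \<in> clopen_of A" "clopen_of A \<subseteq> U"
proof -
  have "\<exists>A. p \<in> clopen_of A \<and> clopen_of A \<subseteq> U"
    using assms unfolding open_nstar_def
  proof (induction U rule: generate_topology.induct)
    case (Int a b)
    then obtain A B where "p \<in> clopen_of A" "clopen_of A \<subseteq> a" "p \<in> clopen_of B" "clopen_of B \<subseteq> b"
      by auto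
    then show ?case
      by (intro exI[of _ "A \<inter> B"]) (auto simp: clopen_of_Int)
  next
    case (UN K)
    then show ?case
      by (meson UnionE Union_upper subset_trans)
  qed (auto simp: clopen_of_UNIV intro: exI[of _ UNIV])
  then show ?thesis
    using that by blast
qed

text \<open>Without a finite subcover, the cofinite sets and the complements of the sets in
  \<open>J\<close> would generate a proper filter, and an ultrafilter finer than it would be a point
  that no member of \<open>C\<close> contains.\<close>

lemma compact_nstar: "compact (UNIV :: nstar set)"
proof (rule compactI)
  fix C :: "nstar set set" assume op: "\<forall>c\<in>C. open c" and cover: "UNIV \<subseteq> \<Union>C"
  define J where "J = {A. \<exists>c\<in>C. clopen_of A \<subseteq> c}"
  define F where "F = inf cofinite (INF A\<in>J. principal (- A))"
  have "F = bot"
  proof (rule ccontr)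
    assume "F \<noteq> bot"
    then obtain p where p: "filter_of p \<le> F"
      by (rule nstar_below_filter) (simp add: F_def)
    obtain c where "c \<in> C" "p \<in> c"
      using cover by auto
    moreover from this op have "open c"
      by blast
    ultimately obtain A where A: "p \<in> clopen_of A" "clopen_of A \<subseteq> c"
      using open_nstarE by blast
    with \<open>c \<in> C\<close> have "A \<in> J"
      by (auto simp: J_def)
    then have "F \<le> principal (- A)"
      unfolding F_def by (intro le_infI2 INF_lower)
    with p have "filter_of p \<le> principal (- A)"
      by (rule order_trans)
    then have "eventually (\<lambda>n. n \<in> - A) (filter_of p)"
      by (simp only: le_principal)
    then have "p \<in> - clopen_of A"
      unfolding Compl_clopen_of by (simp add: clopen_of_def)
    with A show False
      by simp
  qed
  \<comment> \<open>\<open>F = bot\<close> is witnessed by a cofinite set disjoint from the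
    intersection of finitely many complements, so the sets in \<open>X\<close> cover \<nat> up to a
    finite set.\<close>
  then obtain X where X: "X \<subseteq> J" "finite X" and fin: "finite (- (\<Union>X))"
  proof -
    assume *: "\<And>X. X \<subseteq> J \<Longrightarrow> finite X \<Longrightarrow> finite (- (\<Union>X)) \<Longrightarrow> thesis"
    obtain P Q where P: "eventually P cofinite" 
      and Q: "eventually Q (INF A\<in>J. principal (- A))" and PQ: "\<And>n. \<not> (P n \<and> Q n)"
      using \<open>F = bot\<close> unfolding F_def trivial_limit_def eventually_inf by blast
    obtain X where X: "X \<subseteq> J" "finite X" "eventually Q (INF A\<in>X. principal (- A))"
      using Q unfolding eventually_INF[of _ _ J] by blast
    then have "- (\<Union>X) \<subseteq> {n. Q n}"
      by (auto simp: INF_principal_finite eventually_principal)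
    then have "- (\<Union>X) \<subseteq> {n. \<not> P n}"
      using PQ by auto
    with P have "finite (- (\<Union>X))"
      by (auto simp: eventually_cofinite intro: finite_subset)
    with X * show thesis
      by auto
  qed
  have "\<forall>A\<in>X. \<exists>c. c \<in> C \<and> clopen_of A \<subseteq> c"
    using X(1) unfolding J_def by blast
  then obtain c where c: "\<And>A. A \<in> X \<Longrightarrow> c A \<in> C \<and> clopen_of A \<subseteq> c A"
    by metis
  have "clopen_of (\<Union>X) = UNIV"
    using fin eventually_cofinite[of "\<lambda>n. n \<in> \<Union>X"] filter_leD[OF filter_of_le_cofinite]
    by (auto simp: clopen_of_def Compl_eq)
  then have "UNIV = (\<Union>A\<in>X. clopen_of A)"
    using clopen_of_UNION[OF X(2), of "\<lambda>A. A"] by simp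
  also have "\<dots> \<subseteq> \<Union>(c ` X)"
    using c by blast
  finally show "\<exists>C'\<subseteq>C. finite C' \<and> UNIV \<subseteq> \<Union>C'"
    using c X(2) by (intro exI[of _ "c ` X"]) auto
qed

text \<open>Finitely many basic clopen sets inside \<open>U\<close> cover the compact set
  \<open>K\<close>, and their union is again of the form \<open>clopen_of A\<close>.\<close>

lemma clopen_separation:
  assumes K: "closed K" and U: "open U" and "K \<subseteq> U"
  obtains A where "K \<subseteq> clopen_of A" "clopen_of A \<subseteq> U"
proof -
  define J where "J = {A. clopen_of A \<subseteq> U}"
  have "compact K"
    using compact_Int_closed[OF compact_nstar K] by simp
  moreover have "K \<subseteq> (\<Union>A\<in>J. clopen_of A)"
  proof
    fix p assume "p \<in> K"
    then have "p \<in> U"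
      using \<open>K \<subseteq> U\<close> by blast
    with U obtain A where "p \<in> clopen_of A" "clopen_of A \<subseteq> U"
      by (rule open_nstarE)
    then show "p \<in> (\<Union>A\<in>J. clopen_of A)"
      by (auto simp: J_def)
  qed
  ultimately obtain D where D: "D \<subseteq> J" "finite D" "K \<subseteq> (\<Union>A\<in>D. clopen_of A)"
    using compactE_image[of K J clopen_of] open_clopen_of by blast
  then have "K \<subseteq> clopen_of (\<Union>A\<in>D. A)" "clopen_of (\<Union>A\<in>D. A) \<subseteq> U"
    by (simp_all only: clopen_of_UNION[OF D(2)]) (auto simp: J_def)
  then show ?thesis ..
qed

section \<open>Limits of bounded sequences along ultrafilters\<close>

text \<open>For bounded \<open>f\<close> this is the image of the class of \<open>f\<close> under
  the canonical isometry from ell_infinity/c_0 onto the continuous functions.\<close>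

definition ultralimit :: "(nat \<Rightarrow> real) \<Rightarrow> C_nstar"
  where "ultralimit f = Bcontfun (\<lambda>p. Lim (filter_of p) f)"

text \<open>The range has compact closure, so the image of the ultrafilter under \<open>f\<close>
  has a cluster point \<open>l\<close>. As an ultrafilter decides whether
  \<open>f n \<in> U\<close>, the cluster point is a limit.\<close>

lemma tendsto_Lim_filter_of:
  fixes f :: "nat \<Rightarrow> real"
  assumes "bounded (range f)"
  shows "(f \<longlongrightarrow> Lim (filter_of p) f) (filter_of p)"
proof -
  have "compact (closure (range f))"
    using assms by (simp add: compact_closure)
  moreover have "eventually (\<lambda>y. y \<in> closure (range f)) (filtermap f (filter_of p))"
    using closure_subset[of "range f"] by (auto simp: eventually_filtermap intro!: always_eventually)
  ultimately obtain l where l: "inf (nhds l) (filtermap f (filter_of p)) \<noteq> bot"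
    unfolding compact_filter by (metis filter_of_neq_bot filtermap_bot_iff)
  have "(f \<longlongrightarrow> l) (filter_of p)"
  proof (rule topological_tendstoI)
    fix U assume U: "open U" "l \<in> U"
    show "eventually (\<lambda>n. f n \<in> U) (filter_of p)"
    proof (rule ccontr)
      assume "\<not> ?thesis"
      then have "eventually (\<lambda>n. f n \<notin> U) (filter_of p)"
        using filter_of_cases by blast
      then have "eventually (\<lambda>y. y \<notin> U) (filtermap f (filter_of p))"
        by (simp add: eventually_filtermap)
      moreover have "eventually (\<lambda>y. y \<in> U) (nhds l)"
        using U by (rule eventually_nhds_in_open)
      ultimately have "eventually (\<lambda>y. False) (inf (nhds l) (filtermap f (filter_of p)))"
        unfolding eventually_inf by blast
      then show False
        using l by (simp add: trivial_limit_def)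
    qed
  qed
  then show ?thesis
    using tendsto_Lim[OF filter_of_neq_bot] by metis
qed

lemma tendsto_ultralimit:
  fixes f :: "nat \<Rightarrow> real"
  assumes "bounded (range f)"
  shows "(f \<longlongrightarrow> apply_bcontfun (ultralimit f) p) (filter_of p)"
proof -
  obtain b where b: "\<And>n. norm (f n) \<le> b"
    using assms by (auto simp: bounded_iff)
  note lim = tendsto_Lim_filter_of[OF assms]
  have "continuous_on UNIV (\<lambda>p. Lim (filter_of p) f)"
    unfolding continuous_on_def
  proof (intro ballI tendstoI)
    fix p and e :: real assume "e > 0"
    \<comment> \<open>The ultrafilters containing \<open>A\<close> form a neighbourhood of
      \<open>p\<close>. The radius \<open>e / 2\<close> leaves room, since limits preserve only the
      non-strict inequality.\<close>
    define A where "A = {n. dist (f n) (Lim (filter_of p) f) < e / 2}"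
    have "p \<in> clopen_of A"
      using tendstoD[OF lim, of "e / 2" p] \<open>e > 0\<close> by (simp add: A_def clopen_of_def)
    moreover have "dist (Lim (filter_of q) f) (Lim (filter_of p) f) < e" if "q \<in> clopen_of A" for q
    proof -
      have "dist (Lim (filter_of q) f) (Lim (filter_of p) f) \<le> e / 2"
      proof (rule tendsto_upperbound)
        show "((\<lambda>n. dist (f n) (Lim (filter_of p) f)) \<longlongrightarrow> dist (Lim (filter_of q) f) (Lim (filter_of p) f)) (filter_of q)"
          by (intro tendsto_intros lim)
        show "\<forall>\<^sub>F n in filter_of q. dist (f n) (Lim (filter_of p) f) \<le> e / 2"
          using that by (auto simp: A_def clopen_of_def elim!: eventually_mono)
      qed simp
      then show ?thesis
        using \<open>e > 0\<close> by simp
    qed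
    ultimately show "\<forall>\<^sub>F q in at p within UNIV. dist (Lim (filter_of q) f) (Lim (filter_of p) f) < e"
      unfolding eventually_at_topological using open_clopen_of by blast
  qed
  moreover have "norm (Lim (filter_of p) f) \<le> b" for p
  proof (rule tendsto_upperbound)
    show "((\<lambda>n. norm (f n)) \<longlongrightarrow> norm (Lim (filter_of p) f)) (filter_of p)"
      by (intro tendsto_intros lim)
  qed (use b in simp_all)
  ultimately have "(\<lambda>p. Lim (filter_of p) f) \<in> bcontfun"
    by (rule bcontfun_normI)
  then show ?thesis
    using lim by (simp add: ultralimit_def Bcontfun_inverse)
qed

section \<open>The ordinals below \<open>\<omega>\<^sub>1\<close> and the bounding number\<close>

text \<open>Transporting the order of \<open>cardSuc natLeq\<close> to the type makes recursion over
  the countable ordinals available.\<close>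

instantiation omega1 :: wellorder
begin

definition less_eq_omega1 :: "omega1 \<Rightarrow> omega1 \<Rightarrow> bool"
  where "\<alpha> \<le> \<beta> \<longleftrightarrow> (Rep_omega1 \<alpha>, Rep_omega1 \<beta>) \<in> cardSuc natLeq"

definition less_omega1 :: "omega1 \<Rightarrow> omega1 \<Rightarrow> bool"
  where "(\<alpha> :: omega1) < \<beta> \<longleftrightarrow> \<alpha> \<le> \<beta> \<and> \<alpha> \<noteq> \<beta>"

instance
proof -
  have wo: "Well_order (cardSuc natLeq)"
    using cardSuc_Card_order[OF natLeq_Card_order] by (simp add: card_order_on_def)
  then have refl: "Refl (cardSuc natLeq)" and trans: "trans (cardSuc natLeq)"
    and antisym: "antisym (cardSuc natLeq)" and total: "Total (cardSuc natLeq)"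
    and wf: "wf (cardSuc natLeq - Id)"
    by (simp_all add: order_on_defs)
  have le_refl: "\<alpha> \<le> \<alpha>" for \<alpha> :: omega1
    using refl Rep_omega1 by (auto simp: less_eq_omega1_def refl_on_def)
  have le_trans: "\<alpha> \<le> \<gamma>" if "\<alpha> \<le> \<beta>" "\<beta> \<le> \<gamma>" for \<alpha> \<beta> \<gamma> :: omega1
    using that transD[OF trans] by (auto simp: less_eq_omega1_def)
  have le_antisym: "\<alpha> = \<beta>" if "\<alpha> \<le> \<beta>" "\<beta> \<le> \<alpha>" for \<alpha> \<beta> :: omega1
    using that antisymD[OF antisym]
    by (auto simp: less_eq_omega1_def simp flip: Rep_omega1_inject)
  have le_total: "\<alpha> \<le> \<beta> \<or> \<beta> \<le> \<alpha>" for \<alpha> \<beta> :: omega1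
    using total Rep_omega1[of \<alpha>] Rep_omega1[of \<beta>] le_refl[of \<alpha>]
    by (cases "\<alpha> = \<beta>") (auto simp: less_eq_omega1_def total_on_def Rep_omega1_inject)
  have "wf {(\<alpha> :: omega1, \<beta>). \<alpha> < \<beta>}"
  proof (rule wf_subset)
    show "wf (inv_image (cardSuc natLeq - Id) Rep_omega1)"
      using wf by (rule wf_inv_image)
    show "{(\<alpha>, \<beta>). \<alpha> < \<beta>} \<subseteq> inv_image (cardSuc natLeq - Id) Rep_omega1"
      by (auto simp: less_omega1_def less_eq_omega1_def Rep_omega1_inject)
  qed
  then have induct: "P \<alpha>" if "\<And>\<beta>. (\<And>\<gamma>. \<gamma> < \<beta> \<Longrightarrow> P \<gamma>) \<Longrightarrow> P \<beta>" for P and \<alpha> :: omega1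
    using that by (rule wf_induct_rule) blast
  show "OFCLASS(omega1, wellorder_class)"
  proof
    show "P \<alpha>" if "\<And>\<beta>. (\<And>\<gamma>. \<gamma> < \<beta> \<Longrightarrow> P \<gamma>) \<Longrightarrow> P \<beta>" for P and \<alpha> :: omega1
      using that by (rule induct)
  qed (use le_refl le_trans le_antisym le_total in \<open>auto simp: less_omega1_def\<close>)
qed

end

lemma card_of_omega1: "|UNIV :: omega1 set| =o cardSuc natLeq"
proof -
  have "bij_betw Rep_omega1 UNIV (Field (cardSuc natLeq))"
    by (intro bij_betwI[of _ _ _ Abs_omega1])
      (auto simp: Rep_omega1 Rep_omega1_inverse Abs_omega1_inverse)
  then have "|UNIV :: omega1 set| =o |Field (cardSuc natLeq)|"
    by (rule card_of_ordIsoI)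
  also have "|Field (cardSuc natLeq)| =o cardSuc natLeq"
    by (rule card_of_Field_ordIso[OF cardSuc_Card_order[OF natLeq_Card_order]])
  finally show ?thesis .
qed

lemma countable_iff_ordLeq_natLeq: "countable X \<longleftrightarrow> |X| \<le>o natLeq"
proof -
  have "countable X \<longleftrightarrow> |X| \<le>o |UNIV :: nat set|"
    by (auto simp: countable_def card_of_ordLeq[symmetric])
  then show ?thesis
    using card_of_nat ordLeq_ordIso_trans ordIso_symmetric by blast
qed

lemma uncountable_omega1: "uncountable (UNIV :: omega1 set)"
proof
  assume "countable (UNIV :: omega1 set)"
  then have "cardSuc natLeq \<le>o natLeq"
    using ordIso_ordLeq_trans[OF ordIso_symmetric[OF card_of_omega1]]
    by (simp add: countable_iff_ordLeq_natLeq)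
  then show False
    using cardSuc_greater[OF natLeq_Card_order] not_ordLess_ordLeq by blast
qed

text \<open>A proper initial segment of a cardinal has smaller cardinality; below the successor of
  \<open>natLeq\<close> this means at most \<open>natLeq\<close>.\<close>

lemma countable_lessThan_omega1: "countable {..< \<alpha> :: omega1}"
proof -
  have "Rep_omega1 ` {..<\<alpha>} \<subseteq> underS (cardSuc natLeq) (Rep_omega1 \<alpha>)"
    by (auto simp: underS_def less_omega1_def less_eq_omega1_def Rep_omega1_inject)
  moreover have "inj_on Rep_omega1 {..<\<alpha>}"
    by (simp add: inj_on_def Rep_omega1_inject)
  ultimately have "|{..<\<alpha>}| \<le>o |underS (cardSuc natLeq) (Rep_omega1 \<alpha>)|"
    using card_of_ordLeq by blast
  also have "|underS (cardSuc natLeq) (Rep_omega1 \<alpha>)| <o cardSuc natLeq"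
    using cardSuc_Card_order[OF natLeq_Card_order] Rep_omega1 by (rule card_of_underS)
  finally have "|{..<\<alpha>}| <o cardSuc natLeq" .
  then show ?thesis
    using cardSuc_ordLeq_ordLess[OF natLeq_Card_order card_of_Card_order]
    by (auto simp: countable_iff_ordLeq_natLeq)
qed

lemma countable_atMost_omega1: "countable {.. \<alpha> :: omega1}"
proof -
  have "{..\<alpha>} = insert \<alpha> {..<\<alpha>}"
    by auto
  then show ?thesis
    using countable_lessThan_omega1 by simp
qed

text \<open>Otherwise omega_1 would be a countable union of countable initial segments.\<close>

lemma countable_subset_omega1_bounded:
  fixes X :: "omega1 set"
  assumes "countable X"
  obtains \<alpha> where "X \<subseteq> {..\<alpha>}"
proof (rule ccontr)
  assume "\<not> thesis"
  with that have "\<And>\<alpha>. \<exists>\<xi>\<in>X. \<alpha> \<le> \<xi>"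
    by (meson atMost_iff linear subsetI)
  then have "UNIV = (\<Union>\<xi>\<in>X. {..\<xi>})"
    by auto
  moreover have "countable (\<Union>\<xi>\<in>X. {..\<xi>})"
    using assms countable_atMost_omega1 by blast
  ultimately show False
    using uncountable_omega1 by simp
qed

section \<open>Unbounded families and the bounding number\<close>

text \<open>Diagonal bound: \<open>g n\<close> is at least the value at \<open>n\<close> of each of
  the first \<open>n + 1\<close> functions in an enumeration of a countable \<open>F\<close>, so
  \<open>g\<close> dominates every member from its index onwards.\<close>

lemma unbounded_family_uncountable:
  assumes "unbounded_family F"
  shows "natLeq <o |F|"
proof (rule ccontr)
  assume "\<not> natLeq <o |F|"
  then have "countable F"
    using not_ordLess_iff_ordLeq[OF card_of_Well_order natLeq_Well_order, of F]
    by (simp add: countable_iff_ordLeq_natLeq)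
  define g where "g n = (\<Sum>m\<le>n. from_nat_into F m n)" for n
  have "f \<le>* g" if "f \<in> F" for f
    unfolding eventually_dominated_def eventually_sequentially
  proof (intro exI[of _ "to_nat_on F f"] allI impI)
    fix n assume "to_nat_on F f \<le> n"
    then have "from_nat_into F (to_nat_on F f) n \<le> g n"
      unfolding g_def by (intro member_le_sum) auto
    then show "f n \<le> g n"
      using \<open>countable F\<close> that by simp
  qed
  with assms show False
    by (auto simp: unbounded_family_def)
qed

text \<open>The \<open>SOME\<close> in \<open>bounding_number\<close> denotes an actual minimum:
  unbounded families exist, as no \<open>g\<close> dominates \<open>\<lambda>n. Suc (g n)\<close>,
  and cardinals are well-ordered.\<close>

lemma bounding_number_attained:
  obtains F where "unbounded_family F" "bounding_number = |F|"
    "\<And>G. unbounded_family G \<Longrightarrow> |F| \<le>o |G|"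
proof -
  have "unbounded_family UNIV"
    unfolding unbounded_family_def
  proof safe
    fix g assume "\<forall>f\<in>UNIV. f \<le>* g"
    then have "(\<lambda>n. Suc (g n)) \<le>* g"
      by blast
    then show False
      by (simp add: eventually_dominated_def)
  qed
  then have "\<exists>r\<in>{|F| |F. unbounded_family F}. \<forall>r'\<in>{|F| |F. unbounded_family F}. r \<le>o r'"
    by (intro exists_minim_Card_order) (auto intro: card_of_Card_order)
  then have "\<exists>F. unbounded_family F \<and> (\<forall>G. unbounded_family G \<longrightarrow> |F| \<le>o |G| )"
    by blast
  then have "unbounded_family (SOME F. unbounded_family F \<and> (\<forall>G. unbounded_family G \<longrightarrow> |F| \<le>o |G| ))
    \<and> (\<forall>G. unbounded_family G \<longrightarrow> |SOME F. unbounded_family F \<and> (\<forall>G. unbounded_family G \<longrightarrow> |F| \<le>o |G| )| \<le>o |G| )"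
    by (rule someI_ex)
  then show ?thesis
    using that unfolding bounding_number_def by blast
qed

text \<open>If \<open>range f\<close> were unbounded, \<open>bounding_number\<close> would be at
  most the cardinal of omega_1; it is at least that because unbounded families are uncountable,
  which contradicts the assumption.\<close>

lemma bounded_omega1_sequence:
  fixes f :: "omega1 \<Rightarrow> nat \<Rightarrow> nat"
  assumes "\<not> bounding_number =o cardSuc natLeq"
  obtains g where "\<And>\<xi>. f \<xi> \<le>* g"
proof -
  obtain F where F: "unbounded_family F" "bounding_number = |F|"
    "\<And>G. unbounded_family G \<Longrightarrow> |F| \<le>o |G|"
    by (rule bounding_number_attained) blast
  have "\<not> unbounded_family (range f)"
  proof
    assume "unbounded_family (range f)"
    then have "|F| \<le>o |range f|"
      by (rule F)
    also have "|range f| \<le>o |UNIV :: omega1 set|"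
      by (rule card_of_image)
    also have "|UNIV :: omega1 set| =o cardSuc natLeq"
      by (rule card_of_omega1)
    finally have "|F| \<le>o cardSuc natLeq" .
    moreover have "cardSuc natLeq \<le>o |F|"
      using unbounded_family_uncountable[OF F(1)]
        cardSuc_ordLess_ordLeq[OF natLeq_Card_order card_of_Card_order, of F] by blast
    ultimately show False
      using assms F(2) by (simp add: ordIso_iff_ordLeq)
  qed
  then show ?thesis
    using that by (auto simp: unbounded_family_def)
qed

section \<open>Coherent disjoint refinements\<close>

lemma finite_Int_iff_eventually:
  fixes A B :: "nat set"
  shows "finite (A \<inter> B) \<longleftrightarrow> (\<forall>\<^sub>F k in sequentially. k \<in> A \<longrightarrow> k \<notin> B)"
  by (simp add: cofinite_eq_sequentially[symmetric] eventually_cofinite Int_def)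

text \<open>The number \<open>f i n\<close> exceeds all points of \<open>B n \<inter> C i\<close>.
  One \<open>g0\<close> dominating every \<open>f i\<close> empties
  \<open>C i \<inter> (B n - {..<g n})\<close> for all large \<open>n\<close>, which leaves finitely
  many finite intersections.\<close>

lemma disjoint_refinement_orthogonal:
  fixes B :: "nat \<Rightarrow> nat set" and C :: "'i \<Rightarrow> nat set"
  assumes dominated: "\<And>f :: 'i \<Rightarrow> nat \<Rightarrow> nat. \<exists>g. \<forall>i. f i \<le>* g"
    and BB: "\<And>m n. m \<noteq> n \<Longrightarrow> finite (B m \<inter> B n)"
    and BC: "\<And>n i. finite (B n \<inter> C i)"
  shows "\<exists>g. disjoint_family (\<lambda>n. B n - {..<g n}) \<and>
    (\<forall>i. finite ((\<Union>n. B n - {..<g n}) \<inter> C i))"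
proof -
  have "\<forall>i n. \<exists>b. \<forall>k\<in>B n \<inter> C i. k < b"
    using BC finite_nat_set_iff_bounded by blast
  then obtain f where f: "k \<in> B n \<inter> C i \<Longrightarrow> k < f i n" for i n k
    by metis
  have "\<forall>m n. m \<noteq> n \<longrightarrow> (\<exists>b. \<forall>k\<in>B m \<inter> B n. k < b)"
    using BB finite_nat_set_iff_bounded by blast
  then obtain d where d: "m \<noteq> n \<Longrightarrow> k \<in> B m \<inter> B n \<Longrightarrow> k < d m n" for m n k
    by metis
  obtain g0 where g0: "f i \<le>* g0" for i
    using dominated by blast
  \<comment> \<open>The sum is at least the bound \<open>d m n\<close> of each overlap with an
    earlier \<open>B m\<close>, which makes the trimmed sets disjoint.\<close>
  define g where "g n = g0 n + (\<Sum>m<n. d m n)" for n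
  have disj: "(B m - {..<g m}) \<inter> (B n - {..<g n}) = {}" if "m < n" for m n
  proof -
    have "d m n \<le> (\<Sum>m<n. d m n)"
      using that by (intro member_le_sum) auto
    then have "d m n \<le> g n"
      by (simp add: g_def)
    then show ?thesis
      using d[of m n] that by fastforce
  qed
  have "finite ((\<Union>n. B n - {..<g n}) \<inter> C i)" for i
  proof -
    obtain N where N: "f i n \<le> g0 n" if "n \<ge> N" for n
      using g0[of i] by (auto simp: eventually_dominated_def eventually_sequentially)
    have "(\<Union>n. B n - {..<g n}) \<inter> C i \<subseteq> (\<Union>n<N. B n \<inter> C i)"
    proof
      fix k assume "k \<in> (\<Union>n. B n - {..<g n}) \<inter> C i"
      then obtain n where k: "k \<in> B n" "k \<in> C i" "k \<notin> {..<g n}"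
        by blast
      then have "g0 n < f i n"
        using f[of k n i] by (simp add: g_def)
      then have "n < N"
        using N[of n] by (meson leD le_less_linear)
      then show "k \<in> (\<Union>n<N. B n \<inter> C i)"
        using k by blast
    qed
    then show ?thesis
      by (rule finite_subset) (intro finite_UN_I finite_lessThan BC)
  qed
  moreover have "disjoint_family (\<lambda>n. B n - {..<g n})"
    unfolding disjoint_family_on_def
  proof (intro ballI impI)
    fix m n :: nat assume "m \<noteq> n"
    then show "(B m - {..<g m}) \<inter> (B n - {..<g n}) = {}"
      using disj[of m n] disj[of n m] by (cases m n rule: linorder_cases) (auto simp only: Int_commute)
  qed
  ultimately show ?thesis
    by blast
qed

text \<open>From \<open>P n\<close> only the values outside all earlier \<open>L m\<close> are kept; the remaining domains become
  disjoint after finite changes.\<close>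

lemma amalgamate_partial_functions:
  fixes P :: "nat \<Rightarrow> nat \<Rightarrow> 'a option" and L :: "nat \<Rightarrow> 'a set" and C :: "'i \<Rightarrow> nat set"
  assumes dominated: "\<And>f :: 'i \<Rightarrow> nat \<Rightarrow> nat. \<exists>g. \<forall>i. f i \<le>* g"
    and ran: "\<And>n k \<xi>. P n k = Some \<xi> \<Longrightarrow> \<xi> \<in> L n"
    and coherent: "\<And>m n. \<forall>\<^sub>F k in sequentially.
      \<forall>\<xi>. P n k = Some \<xi> \<and> (\<xi> \<in> L m \<or> P m k \<noteq> None) \<longrightarrow> P m k = Some \<xi>"
    and orth: "\<And>n i. finite (dom (P n) \<inter> C i)"
  shows "\<exists>q. (\<forall>k \<xi>. q k = Some \<xi> \<longrightarrow> (\<exists>n. \<xi> \<in> L n)) \<and>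
    (\<forall>n. \<forall>\<^sub>F k in sequentially. \<forall>\<xi>\<in>L n. q k = Some \<xi> \<longleftrightarrow> P n k = Some \<xi>) \<and>
    (\<forall>i. finite (dom q \<inter> C i))"
proof -
  define B where "B n = {k. \<exists>\<xi>. P n k = Some \<xi> \<and> (\<forall>m<n. \<xi> \<notin> L m)}" for n
  \<comment> \<open>At almost all points where \<open>P m\<close> and \<open>P n\<close> are both
    defined they agree, so the value of \<open>P n\<close> lies in \<open>L m\<close>, which
    \<open>B n\<close> excludes.\<close>
  have less: "finite (B m \<inter> B n)" if mn: "m < n" for m n
    unfolding finite_Int_iff_eventually using coherent[where m = n and n = m]
  proof eventually_elim
    case (elim k)
    show ?case
    proof (intro impI notI)
      assume "k \<in> B m" "k \<in> B n"
      then obtain \<xi> \<zeta> where "P m k = Some \<xi>" "P n k = Some \<zeta>" "\<zeta> \<notin> L m"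
        using mn by (auto simp: B_def)
      with elim ran[of m k \<xi>] show False
        by auto
    qed
  qed
  have BB: "finite (B m \<inter> B n)" if "m \<noteq> n" for m n
    using that less[of m n] less[of n m] by (cases m n rule: linorder_cases) (auto simp: Int_commute)
  have BC: "finite (B n \<inter> C i)" for n i
    by (rule finite_subset[OF _ orth[of n i]]) (auto simp: B_def)
  have "\<exists>g. disjoint_family (\<lambda>n. B n - {..<g n}) \<and>
    (\<forall>i. finite ((\<Union>n. B n - {..<g n}) \<inter> C i))"
    using dominated BB BC by (rule disjoint_refinement_orthogonal)
  then obtain g where disj: "disjoint_family (\<lambda>n. B n - {..<g n})"
    and fin: "\<And>i. finite ((\<Union>n. B n - {..<g n}) \<inter> C i)"
    by blast
  \<comment> \<open>After trimming at most one \<open>n\<close> qualifies, so the choice by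
    \<open>SOME\<close> is forced; elsewhere \<open>q\<close> is undefined.\<close>
  define q where "q k = (if \<exists>n. k \<in> B n - {..<g n} then P (SOME n. k \<in> B n - {..<g n}) k else None)" for k
  have q_eq: "q k = P n k" if "k \<in> B n" "g n \<le> k" for k n
  proof -
    have "(SOME n. k \<in> B n - {..<g n}) = n"
    proof (rule some_equality)
      show "k \<in> B n - {..<g n}"
        using that by simp
      show "m = n" if "k \<in> B m - {..<g m}" for m
        using disjoint_family_onD[OF disj, of m n] that \<open>k \<in> B n - {..<g n}\<close> by auto
    qed
    moreover have "\<exists>n. k \<in> B n - {..<g n}"
      using that by auto
    ultimately show ?thesis
      by (simp only: q_def if_True)
  qed
  have q_SomeE: "\<exists>n. k \<in> B n \<and> g n \<le> k \<and> P n k = Some \<xi>" if q: "q k = Some \<xi>" for k \<xi>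
  proof -
    obtain n where "k \<in> B n" "g n \<le> k"
      using q by (auto simp: q_def split: if_splits)
    then show ?thesis
      using q_eq[of k n] q by auto
  qed
  show ?thesis
  proof (intro exI[of _ q] conjI allI impI)
    show "\<exists>n. \<xi> \<in> L n" if "q k = Some \<xi>" for k \<xi>
      using q_SomeE[OF that] ran by blast
    show "finite (dom q \<inter> C i)" for i
      using q_SomeE by (intro finite_subset[OF _ fin[of i]]) (fastforce simp: dom_def)
    show "\<forall>\<^sub>F k in sequentially. \<forall>\<xi>\<in>L n. q k = Some \<xi> \<longleftrightarrow> P n k = Some \<xi>" for n
    \<comment> \<open>For values in \<open>L n\<close> only indices \<open>m \<le> n\<close> matter,
      as later sets \<open>B m\<close> exclude them; so finitely many eventual conditions
      suffice.\<close>
    proof -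
      have "\<forall>\<^sub>F k in sequentially. \<forall>m\<in>{..n}. g m \<le> k"
        by (simp add: eventually_ball_finite_distrib eventually_ge_at_top)
      moreover have "\<forall>\<^sub>F k in sequentially. \<forall>m\<in>{..n}.
        \<forall>\<xi>. P n k = Some \<xi> \<and> (\<xi> \<in> L m \<or> P m k \<noteq> None) \<longrightarrow> P m k = Some \<xi>"
        using coherent by (simp add: eventually_ball_finite_distrib)
      moreover have "\<forall>\<^sub>F k in sequentially. \<forall>m\<in>{..n}.
        \<forall>\<xi>. P m k = Some \<xi> \<and> (\<xi> \<in> L n \<or> P n k \<noteq> None) \<longrightarrow> P n k = Some \<xi>"
        using coherent by (simp add: eventually_ball_finite_distrib)
      ultimately show ?thesis
      proof eventually_elim
        case (elim k)
        show ?case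
        proof (intro ballI iffI)
          fix \<xi> assume "\<xi> \<in> L n" "q k = Some \<xi>"
          obtain m where m: "k \<in> B m" "P m k = Some \<xi>"
            using q_SomeE[OF \<open>q k = Some \<xi>\<close>] by blast
          then have "m \<le> n"
            using \<open>\<xi> \<in> L n\<close> by (auto simp: B_def not_less[symmetric])
          then show "P n k = Some \<xi>"
            using elim(3) m \<open>\<xi> \<in> L n\<close> by blast
        next
          fix \<xi> assume "\<xi> \<in> L n" "P n k = Some \<xi>"
          \<comment> \<open>For the first \<open>m\<close> with \<open>\<xi> \<in> L m\<close>,
            coherence carries the value over to \<open>P m\<close>, and \<open>k\<close> falls into
            \<open>B m\<close>.\<close>
          define m where "m = (LEAST m. \<xi> \<in> L m)"
          have "\<xi> \<in> L m" and "m \<le> n" and "\<forall>j<m. \<xi> \<notin> L j"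
            using \<open>\<xi> \<in> L n\<close> unfolding m_def by (auto intro: LeastI Least_le dest: not_less_Least)
          moreover from this have "P m k = Some \<xi>"
            using elim(2) \<open>P n k = Some \<xi>\<close> by blast
          ultimately show "q k = Some \<xi>"
            using elim(1) q_eq[of k m] by (auto simp: B_def)
        qed
      qed
    qed
  qed
qed

text \<open>The recursion also maintains that the domain of \<open>p \<alpha>\<close> is almost disjoint from
  \<open>A \<eta>\<close> for \<open>\<eta> > \<alpha>\<close>; this is where domination is needed.\<close>

lemma coherent_partial_functions:
  fixes A :: "omega1 \<Rightarrow> nat set"
  assumes dominated: "\<And>f :: omega1 \<Rightarrow> nat \<Rightarrow> nat. \<exists>g. \<forall>i. f i \<le>* g"
    and AA: "\<And>\<xi> \<eta>. \<xi> \<noteq> \<eta> \<Longrightarrow> finite (A \<xi> \<inter> A \<eta>)"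
  shows "\<exists>p :: omega1 \<Rightarrow> nat \<Rightarrow> omega1 option.
    (\<forall>\<alpha> k \<xi>. p \<alpha> k = Some \<xi> \<longrightarrow> \<xi> \<le> \<alpha>) \<and>
    (\<forall>\<alpha> \<xi>. \<xi> \<le> \<alpha> \<longrightarrow> (\<forall>\<^sub>F k in sequentially. p \<alpha> k = Some \<xi> \<longleftrightarrow> k \<in> A \<xi>)) \<and>
    (\<forall>\<alpha> \<beta>. \<alpha> \<le> \<beta> \<longrightarrow>
      (\<forall>\<^sub>F k in sequentially. \<forall>\<xi>\<le>\<alpha>. p \<beta> k = Some \<xi> \<longleftrightarrow> p \<alpha> k = Some \<xi>))"
proof -
  define good where "good p \<alpha> \<longleftrightarrow> (\<forall>k \<xi>. p k = Some \<xi> \<longrightarrow> \<xi> \<le> \<alpha>) \<and>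
    (\<forall>\<xi>\<le>\<alpha>. \<forall>\<^sub>F k in sequentially. p k = Some \<xi> \<longleftrightarrow> k \<in> A \<xi>) \<and>
    (\<forall>\<eta>>\<alpha>. finite (dom p \<inter> A \<eta>))" for p :: "nat \<Rightarrow> omega1 option" and \<alpha>
  define extends where "extends q p \<alpha> \<longleftrightarrow>
    (\<forall>\<^sub>F k in sequentially. \<forall>\<xi>\<le>\<alpha>. q k = Some \<xi> \<longleftrightarrow> p k = Some \<xi>)"
    for p q :: "nat \<Rightarrow> omega1 option" and \<alpha>
  have "\<exists>p. \<forall>\<beta>. good (p \<beta>) \<beta> \<and> (\<forall>\<alpha><\<beta>. extends (p \<beta>) (p \<alpha>) \<alpha>)"
  proof (rule dependent_wellorder_choice)
    fix \<beta> p assume p: "\<And>\<alpha>. \<alpha> < \<beta> \<Longrightarrow> good (p \<alpha>) \<alpha> \<and> (\<forall>\<gamma><\<alpha>. extends (p \<alpha>) (p \<gamma>) \<gamma>)"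
    \<comment> \<open>There are countably many ordinals up to \<beta>, so they can be listed as a
      sequence, possibly with repetitions, as the amalgamation requires.\<close>
    define e where "e = from_nat_into {..\<beta>}"
    have range_e: "range e = {..\<beta>}"
      unfolding e_def by (intro range_from_nat_into countable_atMost_omega1) auto
    \<comment> \<open>An index of \<beta> contributes the new fibre, the constant value \<beta> on
      \<open>A \<beta>\<close>; every other index contributes an earlier \<open>p\<close>.\<close>
    define L where "L n = (if e n = \<beta> then {\<beta>} else {..e n})" for n
    define P where "P n = (if e n = \<beta> then \<lambda>k. if k \<in> A \<beta> then Some \<beta> else None else p (e n))" for n
    have e_le: "e n \<le> \<beta>" for n
      using range_e by auto
    then have e_cases: "e n = \<beta> \<or> e n < \<beta>" for n
      by (auto simp: order_le_less)
    \<comment> \<open>Only the \<open>A \<eta>\<close> with \<open>\<eta> > \<beta>\<close> must be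
      avoided. Empty sets at the other indices keep the index type for which
      \<open>dominated\<close> is stated.\<close>
    define C where "C \<eta> = (if \<beta> < \<eta> then A \<eta> else {})" for \<eta>
    have orth: "finite (dom (P n) \<inter> C \<eta>)" for n \<eta>
    proof (cases "e n = \<beta>")
      case True
      then have "dom (P n) = A \<beta>"
        by (auto simp: P_def dom_def)
      then show ?thesis
        using AA by (auto simp: C_def)
    next
      case False
      then show ?thesis
        using p[of "e n"] e_cases[of n] by (auto simp: P_def C_def good_def)
    qed
    have ran: "\<xi> \<in> L n" if "P n k = Some \<xi>" for n k \<xi>
    proof (cases "e n = \<beta>")
      case True
      then show ?thesis
        using that by (auto simp: P_def L_def split: if_splits)
    next
      case False
      then show ?thesis
        using that p[of "e n"] e_cases[of n] by (auto simp: P_def L_def good_def)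
    qed
    have coherent: "\<forall>\<^sub>F k in sequentially.
      \<forall>\<xi>. P n k = Some \<xi> \<and> (\<xi> \<in> L m \<or> P m k \<noteq> None) \<longrightarrow> P m k = Some \<xi>" for m n
    proof -
      \<comment> \<open>The last clause of \<open>good\<close> for \<alpha>, taken at
        \<open>\<eta> = \<beta>\<close>, makes the new fibre almost disjoint from the domain of
        \<open>p \<alpha>\<close>.\<close>
      have new: "\<forall>\<^sub>F k in sequentially. \<not> (k \<in> A \<beta> \<and> p \<alpha> k \<noteq> None)" if "\<alpha> < \<beta>" for \<alpha>
      proof -
        have "finite (A \<beta> \<inter> dom (p \<alpha>))"
          using p[OF that] that by (simp add: good_def Int_commute)
        then show ?thesis
          unfolding finite_Int_iff_eventually by eventually_elim auto
      qed
      consider "e n = \<beta>" "e m = \<beta>" | "e n = \<beta>" "e m < \<beta>" | "e n < \<beta>" "e m = \<beta>"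
        | "e n < \<beta>" "e m < \<beta>"
        using e_cases by blast
      then show ?thesis
      proof cases
        case 1
        then show ?thesis
          by (simp add: P_def)
      next
        case 2
        show ?thesis
          using new[OF 2(2)] by eventually_elim (use 2 in \<open>auto simp: P_def L_def split: if_splits\<close>)
      next
        case 3
        then have ne: "\<xi> \<noteq> \<beta>" if "p (e n) k = Some \<xi>" for k \<xi>
          using p[OF 3(1)] 3(1) that unfolding good_def by (metis leD)
        show ?thesis
          using new[OF 3(1)] by eventually_elim (use 3 ne in \<open>auto simp: P_def L_def split: if_splits\<close>)
      next
        case 4
        have le: "\<xi> \<le> e i" if "p (e i) k = Some \<xi>" "e i < \<beta>" for i k \<xi>
          using p[of "e i"] that by (auto simp: good_def)
        have eqs: "P n = p (e n)" "P m = p (e m)" "L m = {..e m}"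
          using 4 by (auto simp: P_def L_def)
        consider "e n = e m" | "e n < e m" | "e m < e n"
          by (cases "e n" "e m" rule: linorder_cases)
        then show ?thesis
        proof cases
          case 1
          then show ?thesis
            using 4 by (simp add: P_def)
        next
          case 2
          then have "extends (p (e m)) (p (e n)) (e n)"
            using p[of "e m"] 4 by blast
          then show ?thesis
            unfolding extends_def eqs by eventually_elim (use 4(1) le in blast)
        next
          \<comment> \<open>If \<open>p (e m) k = Some \<zeta>\<close>, then
            \<open>\<zeta> \<le> e m\<close>, so the extension \<open>p (e n)\<close> also has the
            value \<zeta> at \<open>k\<close>, which must be \<xi>. If \<open>p (e m) k\<close> is
            undefined, \<xi> cannot lie in \<open>{..e m}\<close>.\<close>
          case 3
          then have "extends (p (e n)) (p (e m)) (e m)"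
            using p[of "e n"] 4 by blast
          then show ?thesis
            unfolding extends_def eqs
          proof eventually_elim
            case (elim k)
            show ?case
            proof (intro allI impI, elim conjE)
              fix \<xi> assume \<xi>: "p (e n) k = Some \<xi>" "\<xi> \<in> {..e m} \<or> p (e m) k \<noteq> None"
              show "p (e m) k = Some \<xi>"
              proof (cases "p (e m) k")
                case None
                with \<xi> elim show ?thesis
                  by auto
              next
                case (Some \<zeta>)
                then have "p (e n) k = Some \<zeta>"
                  using elim le 4(2) by blast
                with \<xi> Some show ?thesis
                  by simp
              qed
            qed
          qed
        qed
      qed
    qed
    have "\<exists>q. (\<forall>k \<xi>. q k = Some \<xi> \<longrightarrow> (\<exists>n. \<xi> \<in> L n)) \<and>
      (\<forall>n. \<forall>\<^sub>F k in sequentially. \<forall>\<xi>\<in>L n. q k = Some \<xi> \<longleftrightarrow> P n k = Some \<xi>) \<and>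
      (\<forall>\<eta>. finite (dom q \<inter> C \<eta>))"
      using dominated ran coherent orth by (rule amalgamate_partial_functions)
    then obtain q where q_ran: "\<And>k \<xi>. q k = Some \<xi> \<Longrightarrow> \<exists>n. \<xi> \<in> L n"
      and q_P: "\<And>n. \<forall>\<^sub>F k in sequentially. \<forall>\<xi>\<in>L n. q k = Some \<xi> \<longleftrightarrow> P n k = Some \<xi>"
      and q_C: "\<And>\<eta>. finite (dom q \<inter> C \<eta>)"
      by blast
    have ext: "extends q (p \<alpha>) \<alpha>" if "\<alpha> < \<beta>" for \<alpha>
    proof -
      have "\<alpha> \<in> range e"
        using that by (simp add: range_e)
      then obtain n where n: "e n = \<alpha>"
        by blast
      have "\<alpha> \<noteq> \<beta>"
        using that by simp
      then show ?thesis
        using q_P[of n] by (simp add: extends_def L_def P_def n Ball_def)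
    qed
    have "\<forall>\<^sub>F k in sequentially. q k = Some \<xi> \<longleftrightarrow> k \<in> A \<xi>" if "\<xi> \<le> \<beta>" for \<xi>
    proof (cases "\<xi> = \<beta>")
      case True
      have "\<beta> \<in> range e"
        by (simp add: range_e)
      then obtain n where n: "e n = \<beta>"
        by blast
      show ?thesis
        using q_P[of n] by eventually_elim (auto simp: L_def P_def n True)
    next
      case False
      with that have "\<xi> < \<beta>"
        by simp
      then have "\<forall>\<^sub>F k in sequentially. p \<xi> k = Some \<xi> \<longleftrightarrow> k \<in> A \<xi>"
        using p by (auto simp: good_def)
      with ext[OF \<open>\<xi> < \<beta>\<close>] show ?thesis
        unfolding extends_def by eventually_elim auto
    qed
    moreover have "\<xi> \<le> \<beta>" if "q k = Some \<xi>" for k \<xi>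
      using q_ran[OF that] e_le by (auto simp: L_def split: if_splits intro: order_trans)
    moreover have "finite (dom q \<inter> A \<eta>)" if "\<beta> < \<eta>" for \<eta>
      using q_C[of \<eta>] that by (simp add: C_def)
    ultimately have "good q \<beta>"
      by (auto simp: good_def)
    with ext show "\<exists>q. good q \<beta> \<and> (\<forall>\<alpha><\<beta>. extends q (p \<alpha>) \<alpha>)"
      by blast
  qed simp
  then obtain p where p: "\<And>\<beta>. good (p \<beta>) \<beta>" "\<And>\<alpha> \<beta>. \<alpha> < \<beta> \<Longrightarrow> extends (p \<beta>) (p \<alpha>) \<alpha>"
    by blast
  show ?thesis
  proof (intro exI[of _ p] conjI allI impI)
    show "\<forall>\<^sub>F k in sequentially. \<forall>\<xi>\<le>\<alpha>. p \<beta> k = Some \<xi> \<longleftrightarrow> p \<alpha> k = Some \<xi>" if "\<alpha> \<le> \<beta>" for \<alpha> \<beta>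
      using p(2)[of \<alpha> \<beta>] that by (cases "\<alpha> = \<beta>") (auto simp: extends_def)
  qed (use p(1) in \<open>auto simp: good_def\<close>)
qed

section \<open>Isometric embeddings\<close>

lemma linf_c_add:
  assumes "x \<in> linf_c" "y \<in> linf_c"
  shows "x + y \<in> linf_c"
proof -
  have "countable ({i. apply_bcontfun x i \<noteq> 0} \<union> {i. apply_bcontfun y i \<noteq> 0})"
    using assms by (simp add: linf_c_def)
  moreover have "{i. apply_bcontfun (x + y) i \<noteq> 0} \<subseteq> \<dots>"
    by auto
  ultimately show ?thesis
    unfolding linf_c_def mem_Collect_eq by (rule countable_subset[rotated])
qed

lemma linf_c_scaleR:
  assumes "x \<in> linf_c"
  shows "c *\<^sub>R x \<in> linf_c"
proof -
  have "{i. apply_bcontfun (c *\<^sub>R x) i \<noteq> 0} \<subseteq> {i. apply_bcontfun x i \<noteq> 0}"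
    by auto
  then show ?thesis
    using assms unfolding linf_c_def mem_Collect_eq by (rule countable_subset)
qed

lemma char_singleton_in_linf_c: "char_singleton i \<in> linf_c"
  by (simp add: linf_c_def apply_char_singleton indicator_def)

lemma linf_c_bounded_support:
  fixes x :: "omega1 linf"
  assumes "x \<in> linf_c"
  obtains \<gamma> where "\<And>\<xi>. \<gamma> < \<xi> \<Longrightarrow> apply_bcontfun x (discrete \<xi>) = 0"
proof -
  have "countable (of_discrete ` {i. apply_bcontfun x i \<noteq> 0})"
    using assms by (auto simp: linf_c_def)
  then obtain \<gamma> where \<gamma>: "of_discrete ` {i. apply_bcontfun x i \<noteq> 0} \<subseteq> {..\<gamma>}"
    by (rule countable_subset_omega1_bounded)
  have "apply_bcontfun x (discrete \<xi>) = 0" if "\<gamma> < \<xi>" for \<xi>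
  proof (rule ccontr)
    assume "apply_bcontfun x (discrete \<xi>) \<noteq> 0"
    then have "of_discrete (discrete \<xi>) \<in> of_discrete ` {i. apply_bcontfun x i \<noteq> 0}"
      by blast
    then have "\<xi> \<le> \<gamma>"
      using \<gamma> by (auto simp: discrete_inverse)
    with that show False
      by simp
  qed
  then show ?thesis
    using that by blast
qed

section \<open>Construction of the embedding from coherent partial functions\<close>

text \<open>\<open>S x\<close> is the limit along ultrafilters of \<open>x\<close> composed with
  \<open>p \<gamma>\<close>, for any \<gamma> bounding the support of \<open>x\<close>. The
  composition never exceeds \<open>norm x\<close>, and on the nonempty set [A \<xi>] the limit is
  the coordinate of \<open>x\<close> at \<xi>; together this makes \<open>S\<close>
  isometric.\<close>

lemma isometric_embedding_exists:
  fixes A :: "omega1 \<Rightarrow> nat set"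
  assumes b: "\<not> bounding_number =o cardSuc natLeq"
    and "inj A" "almost_disjoint_family (range A)"
  shows "\<exists>S :: omega1 linf \<Rightarrow> C_nstar. isometric_embedding_on linf_c S \<and>
    (\<forall>\<xi>. S (char_singleton \<xi>) = char_clopen (A \<xi>))"
proof -
  have inf: "infinite (A \<xi>)" for \<xi>
    using assms(3) by (simp add: almost_disjoint_family_def)
  have AA: "finite (A \<xi> \<inter> A \<eta>)" if "\<xi> \<noteq> \<eta>" for \<xi> \<eta>
    using assms(3) injD[OF \<open>inj A\<close>, of \<xi> \<eta>] that by (auto simp: almost_disjoint_family_def)
  have dominated: "\<exists>g. \<forall>\<xi>. f \<xi> \<le>* g" for f :: "omega1 \<Rightarrow> nat \<Rightarrow> nat"
    using bounded_omega1_sequence[OF b] by blast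
  have "\<exists>p :: omega1 \<Rightarrow> nat \<Rightarrow> omega1 option.
    (\<forall>\<alpha> k \<xi>. p \<alpha> k = Some \<xi> \<longrightarrow> \<xi> \<le> \<alpha>) \<and>
    (\<forall>\<alpha> \<xi>. \<xi> \<le> \<alpha> \<longrightarrow> (\<forall>\<^sub>F k in sequentially. p \<alpha> k = Some \<xi> \<longleftrightarrow> k \<in> A \<xi>)) \<and>
    (\<forall>\<alpha> \<beta>. \<alpha> \<le> \<beta> \<longrightarrow>
      (\<forall>\<^sub>F k in sequentially. \<forall>\<xi>\<le>\<alpha>. p \<beta> k = Some \<xi> \<longleftrightarrow> p \<alpha> k = Some \<xi>))"
    using dominated AA by (rule coherent_partial_functions)
  then obtain p :: "omega1 \<Rightarrow> nat \<Rightarrow> omega1 option" where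
    "\<forall>\<alpha> k \<xi>. p \<alpha> k = Some \<xi> \<longrightarrow> \<xi> \<le> \<alpha>"
    and "\<forall>\<alpha> \<xi>. \<xi> \<le> \<alpha> \<longrightarrow> (\<forall>\<^sub>F k in sequentially. p \<alpha> k = Some \<xi> \<longleftrightarrow> k \<in> A \<xi>)"
    and "\<forall>\<alpha> \<beta>. \<alpha> \<le> \<beta> \<longrightarrow>
      (\<forall>\<^sub>F k in sequentially. \<forall>\<xi>\<le>\<alpha>. p \<beta> k = Some \<xi> \<longleftrightarrow> p \<alpha> k = Some \<xi>)"
    by (elim exE conjE) (rule that)
  note p_le = this(1)[rule_format] and p_A = this(2)[rule_format]
    and p_coh = this(3)[rule_format (no_asm)]
  \<comment> \<open>Points outside the domain of \<open>p \<gamma>\<close> get \<open>0\<close>, the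
    value that \<open>x\<close> takes beyond its support.\<close>
  define h where "h \<gamma> x k = (case p \<gamma> k of None \<Rightarrow> 0 | Some \<xi> \<Rightarrow> apply_bcontfun x (discrete \<xi>))"
    for \<gamma> k and x :: "omega1 linf"
  define supp where "supp x \<gamma> \<longleftrightarrow> (\<forall>\<xi>>\<gamma>. apply_bcontfun x (discrete \<xi>) = 0)"
    for x :: "omega1 linf" and \<gamma>
  \<comment> \<open>The choice of the bound is immaterial: by \<open>S_lim\<close> below, every
    bound of the support gives the same limits.\<close>
  define S where "S x = ultralimit (h (SOME \<gamma>. supp x \<gamma>) x)" for x
  have h_le: "norm (h \<gamma> x k) \<le> norm x" for \<gamma> x k
    using norm_bounded[of x] by (auto simp: h_def split: option.split)
  have bdd: "bounded (range (h \<gamma> x))" for \<gamma> x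
    using h_le by (auto simp: bounded_iff)
  have supp_ex: "\<exists>\<gamma>. supp x \<gamma>" if x: "x \<in> linf_c" for x
    using linf_c_bounded_support[OF x] by (auto simp: supp_def)
  have supp_mono: "supp x \<gamma>" if "supp x \<alpha>" "\<alpha> \<le> \<gamma>" for x \<alpha> \<gamma>
    using that by (auto simp: supp_def)
  have h_coh: "\<forall>\<^sub>F k in sequentially. h \<alpha> x k = h \<gamma> x k" if supp: "supp x \<alpha>" and "\<alpha> \<le> \<gamma>" for x \<alpha> \<gamma>
    using p_coh[OF \<open>\<alpha> \<le> \<gamma>\<close>]
  proof eventually_elim
    case (elim k)
    show ?case
    proof (cases "p \<alpha> k")
      case (Some \<xi>)
      then have "p \<gamma> k = Some \<xi>"
        using elim p_le by blast
      with Some show ?thesis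
        by (simp add: h_def)
    next
      \<comment> \<open>A point where \<open>p \<gamma>\<close> is defined and
        \<open>p \<alpha>\<close> is not carries a value above \<alpha>, where \<open>x\<close>
        vanishes; this matches the default \<open>0\<close>.\<close>
      case None
      then have "\<alpha> < \<xi>" if "p \<gamma> k = Some \<xi>" for \<xi>
        using elim that by (metis not_le option.distinct(1))
      then show ?thesis
        using None supp by (auto simp: h_def supp_def split: option.split)
    qed
  qed
  have S_lim: "(h \<gamma> x \<longlongrightarrow> apply_bcontfun (S x) q) (filter_of q)" if \<gamma>: "supp x \<gamma>" for x \<gamma> q
  proof -
    define \<alpha> where "\<alpha> = (SOME \<gamma>. supp x \<gamma>)"
    have \<alpha>: "supp x \<alpha>"
      unfolding \<alpha>_def using \<gamma> by (rule someI)
    have "\<forall>\<^sub>F k in sequentially. h \<alpha> x k = h \<gamma> x k"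
    proof (cases "\<alpha> \<le> \<gamma>")
      case True
      then show ?thesis
        using \<alpha> h_coh by blast
    next
      case False
      then have "\<forall>\<^sub>F k in sequentially. h \<gamma> x k = h \<alpha> x k"
        using h_coh[OF \<gamma>, of \<alpha>] by simp
      then show ?thesis
        by (simp add: eq_commute)
    qed
    then have "\<forall>\<^sub>F k in filter_of q. h \<alpha> x k = h \<gamma> x k"
      by (rule eventually_filter_of_if_sequentially)
    moreover have "(h \<alpha> x \<longlongrightarrow> apply_bcontfun (S x) q) (filter_of q)"
      unfolding S_def \<alpha>_def[symmetric] by (rule tendsto_ultralimit[OF bdd])
    ultimately show ?thesis
      by (rule Lim_transform_eventually[rotated])
  qed
  have S_eq: "apply_bcontfun (S x) q = l"
    if "supp x \<gamma>" "(h \<gamma> x \<longlongrightarrow> l) (filter_of q)" for x \<gamma> q l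
    using tendsto_unique[OF filter_of_neq_bot S_lim[OF that(1)] that(2)] .
  have S_at: "apply_bcontfun (S x) q = apply_bcontfun x (discrete \<xi>)"
    if x: "x \<in> linf_c" and q: "q \<in> clopen_of (A \<xi>)" for x q \<xi>
  proof -
    obtain \<alpha> where \<alpha>: "supp x \<alpha>"
      using supp_ex[OF x] ..
    \<comment> \<open>The maximum bounds the support and also reaches \<xi>, so that
      \<open>p \<gamma>\<close> has a fibre almost equal to \<open>A \<xi>\<close>.\<close>
    define \<gamma> where "\<gamma> = max \<alpha> \<xi>"
    have "supp x \<gamma>"
      using \<alpha> by (rule supp_mono) (simp add: \<gamma>_def)
    moreover have "(h \<gamma> x \<longlongrightarrow> apply_bcontfun x (discrete \<xi>)) (filter_of q)"
    proof (rule tendsto_eventually)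
      have "\<forall>\<^sub>F k in filter_of q. p \<gamma> k = Some \<xi> \<longleftrightarrow> k \<in> A \<xi>"
        using p_A[of \<xi> \<gamma>] by (intro eventually_filter_of_if_sequentially) (simp add: \<gamma>_def)
      moreover have "\<forall>\<^sub>F k in filter_of q. k \<in> A \<xi>"
        using q by (simp add: clopen_of_def)
      ultimately show "\<forall>\<^sub>F k in filter_of q. h \<gamma> x k = apply_bcontfun x (discrete \<xi>)"
        by eventually_elim (simp add: h_def)
    qed
    ultimately show ?thesis
      by (rule S_eq)
  qed
  have "S (x + y) = S x + S y" if x: "x \<in> linf_c" and y: "y \<in> linf_c" for x y
  proof (rule bcontfun_eqI)
    fix q
    obtain \<alpha> \<beta> where "supp x \<alpha>" "supp y \<beta>"
      using supp_ex[OF x] supp_ex[OF y] by blast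
    then have s: "supp x (max \<alpha> \<beta>)" "supp y (max \<alpha> \<beta>)"
      by (auto intro: supp_mono)
    then have "supp (x + y) (max \<alpha> \<beta>)"
      by (simp add: supp_def)
    moreover have "h \<gamma> (x + y) = (\<lambda>k. h \<gamma> x k + h \<gamma> y k)" for \<gamma>
      by (auto simp: h_def fun_eq_iff split: option.split)
    then have "(h (max \<alpha> \<beta>) (x + y) \<longlongrightarrow> apply_bcontfun (S x) q + apply_bcontfun (S y) q) (filter_of q)"
      using tendsto_add[OF S_lim[OF s(1)] S_lim[OF s(2)]] by simp
    ultimately show "apply_bcontfun (S (x + y)) q = apply_bcontfun (S x + S y) q"
      using S_eq by simp
  qed
  moreover have "S (c *\<^sub>R x) = c *\<^sub>R S x" if x: "x \<in> linf_c" for c x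
  proof (rule bcontfun_eqI)
    fix q
    obtain \<gamma> where s: "supp x \<gamma>"
      using supp_ex[OF x] ..
    then have "supp (c *\<^sub>R x) \<gamma>"
      by (simp add: supp_def)
    moreover have "h \<gamma> (c *\<^sub>R x) = (\<lambda>k. c *\<^sub>R h \<gamma> x k)"
      by (auto simp: h_def fun_eq_iff split: option.split)
    then have "(h \<gamma> (c *\<^sub>R x) \<longlongrightarrow> c *\<^sub>R apply_bcontfun (S x) q) (filter_of q)"
      using tendsto_scaleR[OF tendsto_const S_lim[OF s]] by metis
    ultimately show "apply_bcontfun (S (c *\<^sub>R x)) q = apply_bcontfun (c *\<^sub>R S x) q"
      using S_eq by simp
  qed
  moreover have "norm (S x) = norm x" if x: "x \<in> linf_c" for x
  proof (rule antisym)
    obtain \<gamma> where s: "supp x \<gamma>"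
      using supp_ex[OF x] ..
    show "norm (S x) \<le> norm x"
    proof (rule norm_bound)
      fix q
      show "norm (apply_bcontfun (S x) q) \<le> norm x"
        by (rule tendsto_upperbound[OF tendsto_norm[OF S_lim[OF s]]]) (use h_le in simp_all)
    qed
    show "norm x \<le> norm (S x)"
    proof (rule norm_bound)
      fix i
      obtain q where "q \<in> clopen_of (A (of_discrete i))"
        using inf by (rule clopen_of_nonempty)
      then have "apply_bcontfun x i = apply_bcontfun (S x) q"
        using S_at[OF x] by (simp add: of_discrete_inverse)
      then show "norm (apply_bcontfun x i) \<le> norm (S x)"
        using norm_bounded[of "S x" q] by simp
    qed
  qed
  ultimately have "isometric_embedding_on linf_c S"
    by (simp add: isometric_embedding_on_def)
  moreover have "S (char_singleton \<xi>) = char_clopen (A \<xi>)" for \<xi>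
  proof (rule bcontfun_eqI)
    fix q
    have "apply_bcontfun (S (char_singleton \<xi>)) q = indicator (clopen_of (A \<xi>)) q"
    proof (cases "q \<in> clopen_of (A \<xi>)")
      case True
      then show ?thesis
        using S_at[OF char_singleton_in_linf_c True] by (simp add: apply_char_singleton)
    next
      case False
      \<comment> \<open>With the bound \<xi>, \<open>h\<close> is the indicator of the fibre over
        \<xi>, which is almost equal to \<open>A \<xi>\<close>; hence it is eventually
        \<open>0\<close> along \<open>q\<close>.\<close>
      have "supp (char_singleton \<xi>) \<xi>"
        by (auto simp: supp_def apply_char_singleton indicator_def discrete_inject)
      moreover have "(h \<xi> (char_singleton \<xi>) \<longlongrightarrow> 0) (filter_of q)"
      proof (rule tendsto_eventually)
        have "\<forall>\<^sub>F k in filter_of q. p \<xi> k = Some \<xi> \<longleftrightarrow> k \<in> A \<xi>"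
          using p_A[of \<xi> \<xi>] by (intro eventually_filter_of_if_sequentially) simp
        moreover have "\<forall>\<^sub>F k in filter_of q. k \<notin> A \<xi>"
          using False filter_of_cases[of "\<lambda>k. k \<in> A \<xi>" q] by (simp add: clopen_of_def)
        ultimately show "\<forall>\<^sub>F k in filter_of q. h \<xi> (char_singleton \<xi>) k = 0"
          by eventually_elim
            (auto simp: h_def apply_char_singleton indicator_def discrete_inject split: option.split)
      qed
      ultimately show ?thesis
        using S_eq False by simp
    qed
    then show "apply_bcontfun (S (char_singleton \<xi>)) q = apply_bcontfun (char_clopen (A \<xi>)) q"
      by (simp add: apply_char_clopen)
  qed
  ultimately show ?thesis
    by blast
qed

section \<open>Separation of subfamilies by isometric embeddings\<close>

text \<open>As \<open>u\<close> is \<open>0\<close> at \<xi>, adding \<open>1\<close> or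
  \<open>-1\<close> there keeps the norm at most \<open>1\<close>. At \<open>q\<close> the image
  changes by the same amount, and a real number that stays within \<open>[-1, 1]\<close> under both
  changes is \<open>0\<close>.\<close>

lemma isometric_embedding_vanishes:
  fixes S :: "'k linf \<Rightarrow> C_nstar"
  assumes S: "isometric_embedding_on linf_c S" "S (char_singleton \<xi>) = char_clopen B"
    and u: "u \<in> linf_c" "norm u \<le> 1" "apply_bcontfun u (discrete \<xi>) = 0"
    and q: "q \<in> clopen_of B"
  shows "apply_bcontfun (S u) q = 0"
proof -
  have "norm (apply_bcontfun (S u) q + c) \<le> 1" if c: "\<bar>c\<bar> = 1" for c :: real
  proof -
    let ?v = "u + c *\<^sub>R char_singleton \<xi>"
    have "S ?v = S u + c *\<^sub>R char_clopen B"
      using S u(1) char_singleton_in_linf_c[of \<xi>] linf_c_scaleR[OF char_singleton_in_linf_c, of c \<xi>]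
      by (simp add: isometric_embedding_on_def)
    then have "apply_bcontfun (S u) q + c = apply_bcontfun (S ?v) q"
      using q by (simp add: apply_char_clopen)
    also have "norm \<dots> \<le> norm (S ?v)"
      by (rule norm_bounded)
    also have "\<dots> = norm ?v"
      using S(1) linf_c_add[OF u(1) linf_c_scaleR[OF char_singleton_in_linf_c]]
      by (simp add: isometric_embedding_on_def)
    also have "\<dots> \<le> 1"
    proof (rule norm_bound)
      fix i
      show "norm (apply_bcontfun ?v i) \<le> 1"
      proof (cases "i = discrete \<xi>")
        case True
        then show ?thesis
          using c u(3) by (simp add: apply_char_singleton)
      next
        case False
        then show ?thesis
          using u(2) norm_bounded[of u i] by (simp add: apply_char_singleton)
      qed
    qed
    finally show ?thesis .
  qed
  from this[of 1] this[of "-1"] show ?thesis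
    by simp
qed

lemma bcontfun_discrete:
  fixes f :: "'k discrete \<Rightarrow> real"
  assumes "bounded (range f)"
  shows "apply_bcontfun (Bcontfun f) = f"
  using assms by (simp add: Bcontfun_inverse bcontfun_def continuous_on_open_vimage open_discrete)

text \<open>Countability of \<open>N\<close> puts its characteristic function \<open>x\<close> into
  \<open>linf_c\<close>; a clopen set between two level sets of \<open>S x\<close> then provides
  \<open>C\<close>.\<close>

lemma isometric_embedding_separates:
  fixes S :: "'k linf \<Rightarrow> C_nstar"
  assumes S: "isometric_embedding_on linf_c S" "\<And>\<xi>. S (char_singleton \<xi>) = char_clopen (A \<xi>)"
    and N: "countable N"
  obtains C where "\<And>\<xi>. \<xi> \<in> N \<Longrightarrow> finite (A \<xi> - C)" "\<And>\<xi>. \<xi> \<notin> N \<Longrightarrow> finite (A \<xi> \<inter> C)"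
proof -
  \<comment> \<open>\<open>S x\<close> is \<open>1\<close> on \<open>[A \<xi>]\<close> for \<open>\<xi> \<in> N\<close> and \<open>0\<close> on \<open>[A \<xi>]\<close> for \<open>\<xi> \<notin> N\<close>.\<close>
  define x :: "'k linf" where "x = Bcontfun (indicator (discrete ` N))"
  have x: "apply_bcontfun x = indicator (discrete ` N)"
    unfolding x_def by (rule bcontfun_discrete, rule bounded_subset[of "{0, 1}"]) (auto simp: indicator_def)
  have x_at: "apply_bcontfun x (discrete \<xi>) = indicator N \<xi>" for \<xi>
    by (auto simp: x indicator_def discrete_inject)
  have x_mem: "x \<in> linf_c"
    using N by (auto simp: linf_c_def x indicator_def)
  have out: "apply_bcontfun (S x) q = 0" if "\<xi> \<notin> N" "q \<in> clopen_of (A \<xi>)" for \<xi> q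
  proof (rule isometric_embedding_vanishes[OF S x_mem _ _ that(2)])
    show "norm x \<le> 1"
      by (rule norm_bound) (auto simp: x indicator_def)
  qed (use that x_at in simp)
  have "apply_bcontfun (S x) q = 1" if "\<xi> \<in> N" "q \<in> clopen_of (A \<xi>)" for \<xi> q
  proof -
    \<comment> \<open>Removing the unit at \<xi> leaves a vector vanishing at \<xi>. Its image is
      \<open>0\<close> at \<open>q\<close>, so \<open>S x\<close> agrees there with the image of the
      unit.\<close>
    let ?u = "x + (- 1) *\<^sub>R char_singleton \<xi>"
    have e: "(- 1) *\<^sub>R char_singleton \<xi> \<in> linf_c"
      by (intro linf_c_scaleR char_singleton_in_linf_c)
    have "apply_bcontfun (S ?u) q = 0"
    proof (rule isometric_embedding_vanishes[OF S _ _ _ that(2)])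
      show "?u \<in> linf_c"
        by (intro linf_c_add x_mem e)
      show "norm ?u \<le> 1"
        by (rule norm_bound) (use that(1) in \<open>auto simp: x apply_char_singleton indicator_def\<close>)
      show "apply_bcontfun ?u (discrete \<xi>) = 0"
        using that(1) by (simp add: x apply_char_singleton)
    qed
    moreover have "S ?u = S x + (- 1) *\<^sub>R char_clopen (A \<xi>)"
      using S x_mem e char_singleton_in_linf_c unfolding isometric_embedding_on_def by metis
    ultimately show ?thesis
      using that(2) by (simp add: apply_char_clopen)
  qed
  note inside = this
  have cont: "continuous_on UNIV (apply_bcontfun (S x))"
    by simp
  \<comment> \<open>The closed set contains the points with value \<open>1\<close>, the open set
    omits those with value \<open>0\<close>; \<open>1 / 2\<close> is just a threshold in
    between.\<close>
  have "closed {q. 1 / 2 \<le> apply_bcontfun (S x) q}"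
    by (intro closed_Collect_le continuous_on_const cont)
  moreover have "open {q. 0 < apply_bcontfun (S x) q}"
    by (intro open_Collect_less continuous_on_const cont)
  moreover have "{q. 1 / 2 \<le> apply_bcontfun (S x) q} \<subseteq> {q. 0 < apply_bcontfun (S x) q}"
    by auto
  ultimately obtain C where C: "{q. 1 / 2 \<le> apply_bcontfun (S x) q} \<subseteq> clopen_of C"
    "clopen_of C \<subseteq> {q. 0 < apply_bcontfun (S x) q}"
    by (rule clopen_separation)
  show ?thesis
  proof
    fix \<xi> assume "\<xi> \<in> N"
    then have "clopen_of (A \<xi>) \<subseteq> clopen_of C"
      using C(1) inside by fastforce
    then show "finite (A \<xi> - C)"
      by (rule finite_diff_if_clopen_of_subset)
  next
    fix \<xi> assume "\<xi> \<notin> N"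
    then have "clopen_of (A \<xi>) \<subseteq> - clopen_of C"
      using C(2) out by fastforce
    then have "finite (A \<xi> - (- C))"
      unfolding Compl_clopen_of by (rule finite_diff_if_clopen_of_subset)
    then show "finite (A \<xi> \<inter> C)"
      by (simp add: Diff_eq)
  qed
qed

section \<open>The almost disjoint family of columns and graphs\<close>

text \<open>Coding the restrictions of \<open>f\<close> to initial segments makes the graphs of distinct functions
  almost disjoint.\<close>

definition course :: "(nat \<Rightarrow> nat) \<Rightarrow> nat \<Rightarrow> nat"
  where "course f n = list_encode (map f [0..<Suc n])"

lemma le_list_encode: "x \<in> set xs \<Longrightarrow> x \<le> list_encode xs"
proof (induction xs)
  case (Cons y ys)
  have "y \<le> prod_encode (y, list_encode ys)" "list_encode ys \<le> prod_encode (y, list_encode ys)"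
    by (rule le_prod_encode_1, rule le_prod_encode_2)
  with Cons show ?case
    by fastforce
qed simp

lemma le_course: "f n \<le> course f n"
  unfolding course_def by (rule le_list_encode) simp

lemma course_eqD: "course f n = course g n \<Longrightarrow> j \<le> n \<Longrightarrow> f j = g j"
  by (auto simp: course_def list_encode_eq)

text \<open>Codes of subsets of nat x nat; the sum type makes columns and graphs a single indexed
  family.\<close>

definition column_or_graph :: "nat + (nat \<Rightarrow> nat) \<Rightarrow> nat set"
  where "column_or_graph u = (case u of
    Inl n \<Rightarrow> range (\<lambda>m. prod_encode (n, m)) | Inr f \<Rightarrow> range (\<lambda>n. prod_encode (n, course f n)))"

lemma infinite_column_or_graph: "infinite (column_or_graph u)"
proof (cases u)
  case (Inl n)
  have "inj (\<lambda>m. prod_encode (n, m))"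
    by (simp add: inj_def)
  then show ?thesis
    by (simp add: column_or_graph_def Inl range_inj_infinite)
next
  case (Inr f)
  have "inj (\<lambda>n. prod_encode (n, course f n))"
    by (simp add: inj_def)
  then show ?thesis
    by (simp add: column_or_graph_def Inr range_inj_infinite)
qed

text \<open>Columns are disjoint, and a graph meets a column in one point. Once
  \<open>f j \<noteq> g j\<close>, the graphs for \<open>f\<close> and \<open>g\<close> cannot meet
  at any \<open>n \<ge> j\<close>, since \<open>course\<close> records all values up to
  \<open>n\<close>.\<close>

lemma finite_column_or_graph_Int:
  assumes "u \<noteq> v"
  shows "finite (column_or_graph u \<inter> column_or_graph v)"
proof -
  have mixed: "finite (column_or_graph (Inl n) \<inter> column_or_graph (Inr f))" for n f
    by (rule finite_subset[of _ "{prod_encode (n, course f n)}"]) (auto simp: column_or_graph_def)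
  consider n m where "u = Inl n" "v = Inl m" | n f where "u = Inl n" "v = Inr f"
    | n f where "u = Inr f" "v = Inl n" | f g where "u = Inr f" "v = Inr g"
    by (cases u; cases v) auto
  then show ?thesis
  proof cases
    case 1
    then have "column_or_graph u \<inter> column_or_graph v = {}"
      using assms by (auto simp: column_or_graph_def)
    then show ?thesis
      by simp
  next
    case 2
    then show ?thesis
      by (simp add: mixed)
  next
    case 3
    then show ?thesis
      using mixed by (simp add: Int_commute)
  next
    case 4
    with assms obtain j where j: "f j \<noteq> g j"
      by auto
    have "column_or_graph u \<inter> column_or_graph v \<subseteq> (\<lambda>n. prod_encode (n, course f n)) ` {..<j}"
    proof
      fix k assume "k \<in> column_or_graph u \<inter> column_or_graph v"
      then obtain n where n: "k = prod_encode (n, course f n)" "course f n = course g n"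
        using 4 by (auto simp: column_or_graph_def)
      then have "n < j"
        using course_eqD[OF n(2), of j] j by (meson not_le)
      with n show "k \<in> (\<lambda>n. prod_encode (n, course f n)) ` {..<j}"
        by blast
    qed
    then show ?thesis
      by (rule finite_subset) simp
  qed
qed

text \<open>Let \<open>g n\<close> bound the codes in column \<open>n\<close> missing from
  \<open>C\<close>. If the graph for \<open>f\<close> is almost disjoint from \<open>C\<close>, then
  almost all its points are among these codes; each is at least \<open>f n\<close> and lies below
  \<open>g n\<close>.\<close>

lemma column_or_graph_separation_bounds:
  assumes columns: "\<And>n. finite (column_or_graph (Inl n) - C)"
  obtains g where "\<And>f. finite (column_or_graph (Inr f) \<inter> C) \<Longrightarrow> f \<le>* g"
proof -
  have "\<forall>n. \<exists>b. \<forall>k\<in>column_or_graph (Inl n) - C. k < b"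
    using columns finite_nat_set_iff_bounded by blast
  then obtain g where g: "\<And>n k. k \<in> column_or_graph (Inl n) \<Longrightarrow> k \<notin> C \<Longrightarrow> k < g n"
    by (metis DiffI)
  have "f \<le>* g" if fin: "finite (column_or_graph (Inr f) \<inter> C)" for f
  proof -
    let ?e = "\<lambda>n. prod_encode (n, course f n)"
    have "finite (?e -` (column_or_graph (Inr f) \<inter> C))"
      using fin by (rule finite_vimageI) (simp add: inj_def)
    then have "\<forall>\<^sub>F n in sequentially. ?e n \<notin> C"
      unfolding cofinite_eq_sequentially[symmetric] eventually_cofinite
      by (rule rev_finite_subset) (auto simp: column_or_graph_def)
    then show ?thesis
      unfolding eventually_dominated_def
    proof eventually_elim
      case (elim n)
      have "f n \<le> ?e n"
        using le_course le_prod_encode_2 by (rule order_trans)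
      also have "?e n < g n"
        using elim by (intro g) (auto simp: column_or_graph_def)
      finally show ?case
        by simp
    qed
  qed
  then show ?thesis
    using that by blast
qed

lemma non_embeddable_family_exists:
  assumes b: "bounding_number =o cardSuc natLeq"
  shows "\<exists>A :: omega1 \<Rightarrow> nat set. inj A \<and> almost_disjoint_family (range A) \<and>
    \<not> (\<exists>S :: omega1 linf \<Rightarrow> C_nstar. isometric_embedding_on linf_c S \<and>
        (\<forall>\<xi>. S (char_singleton \<xi>) = char_clopen (A \<xi>)))"
proof -
  obtain F where F: "unbounded_family F" "bounding_number = |F|"
    by (rule bounding_number_attained) blast
  have "infinite F"
  proof
    assume "finite F"
    then have "countable F"
      by (rule countable_finite)
    then have "|F| \<le>o natLeq"
      by (simp add: countable_iff_ordLeq_natLeq)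
    then show False
      using unbounded_family_uncountable[OF F(1)] not_ordLess_ordLeq by blast
  qed
  \<comment> \<open>Adding countably many columns does not change the cardinality of the infinite
    set \<open>F\<close>, so the whole family can be indexed by omega_1.\<close>
  moreover have "|UNIV :: nat set| \<le>o |F|"
    using ordIso_ordLeq_trans[OF card_of_nat ordLess_imp_ordLeq[OF unbounded_family_uncountable[OF F(1)]]] .
  ultimately have "|(UNIV :: nat set) <+> F| =o |F|"
    by (rule card_of_Plus_infinite2)
  also have "|F| =o cardSuc natLeq"
    using b F(2) by simp
  also have "cardSuc natLeq =o |UNIV :: omega1 set|"
    using card_of_omega1 by (rule ordIso_symmetric)
  finally have "|UNIV :: omega1 set| =o |(UNIV :: nat set) <+> F|"
    by (rule ordIso_symmetric)
  then obtain \<phi> where \<phi>: "bij_betw \<phi> (UNIV :: omega1 set) ((UNIV :: nat set) <+> F)"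
    using card_of_ordIso by blast
  then have inj: "inj \<phi>" and range: "range \<phi> = UNIV <+> F"
    by (auto simp: bij_betw_def)
  define A where "A \<xi> = column_or_graph (\<phi> \<xi>)" for \<xi>
  have fin: "finite (A \<xi> \<inter> A \<eta>)" if "\<xi> \<noteq> \<eta>" for \<xi> \<eta>
    unfolding A_def by (rule finite_column_or_graph_Int) (use inj that in \<open>auto dest: injD\<close>)
  have "inj A"
  proof (rule injI, rule ccontr)
    fix \<xi> \<eta> assume "A \<xi> = A \<eta>" "\<xi> \<noteq> \<eta>"
    then show False
      using fin[of \<xi> \<eta>] infinite_column_or_graph by (simp add: A_def)
  qed
  moreover have "almost_disjoint_family (range A)"
    unfolding almost_disjoint_family_def
  proof (intro conjI)
    show "infinite (range A)"
      using \<open>inj A\<close> uncountable_omega1 by (auto dest: finite_imageD intro: countable_finite)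
    show "\<forall>B\<in>range A. infinite B"
      using infinite_column_or_graph by (simp add: A_def)
    show "\<forall>B\<in>range A. \<forall>C\<in>range A. B \<noteq> C \<longrightarrow> finite (B \<inter> C)"
      using fin by (metis imageE)
  qed
  moreover have False if S: "isometric_embedding_on linf_c S"
    "\<And>\<xi>. S (char_singleton \<xi>) = char_clopen (A \<xi>)" for S :: "omega1 linf \<Rightarrow> C_nstar"
  proof -
    \<comment> \<open>There are countably many columns, so their indices form a set to which the
      separation applies.\<close>
    have "countable (inv \<phi> ` range Inl)"
      by simp
    moreover have "\<phi> -` range Inl \<subseteq> inv \<phi> ` range Inl"
      using inv_f_f[OF inj] by (force intro: image_eqI[OF sym])
    ultimately have "countable (\<phi> -` range Inl)"
      by (rule countable_subset[rotated])
    with S obtain C where C: "\<And>\<xi>. \<xi> \<in> \<phi> -` range Inl \<Longrightarrow> finite (A \<xi> - C)"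
      "\<And>\<xi>. \<xi> \<notin> \<phi> -` range Inl \<Longrightarrow> finite (A \<xi> \<inter> C)"
      by (rule isometric_embedding_separates) blast
    have "finite (column_or_graph (Inl n) - C)" for n
    proof -
      have "Inl n \<in> range \<phi>"
        by (auto simp: range)
      then obtain \<xi> where "\<phi> \<xi> = Inl n"
        by (metis imageE)
      then show ?thesis
        using C(1)[of \<xi>] by (simp add: A_def)
    qed
    then obtain g where g: "\<And>f. finite (column_or_graph (Inr f) \<inter> C) \<Longrightarrow> f \<le>* g"
      using column_or_graph_separation_bounds by blast
    \<comment> \<open>Graphs carry indices outside the preimage of \<open>range Inl\<close>, hence
      are almost disjoint from \<open>C\<close>, so \<open>g\<close> dominates all of
      \<open>F\<close>.\<close>
    have "f \<le>* g" if "f \<in> F" for f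
    proof -
      have "Inr f \<in> range \<phi>"
        using that by (auto simp: range)
      then obtain \<xi> where \<xi>: "\<phi> \<xi> = Inr f"
        by (metis imageE)
      then have "\<xi> \<notin> \<phi> -` range Inl"
        by auto
      from C(2)[OF this] \<xi> show ?thesis
        by (intro g) (simp add: A_def)
    qed
    then show False
      using F(1) by (auto simp: unbounded_family_def)
  qed
  ultimately show ?thesis
    by blast
qed

theorem theorem1p5:
  shows "bounding_number =o cardSuc natLeq \<longleftrightarrow>
    (\<exists>A :: omega1 \<Rightarrow> nat set.
       inj A \<and> almost_disjoint_family (range A) \<and>
       \<not> (\<exists>S :: omega1 linf \<Rightarrow> C_nstar.
             isometric_embedding_on linf_c S \<and>
             (\<forall>\<xi>. S (char_singleton \<xi>) = char_clopen (A \<xi>))))"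
  using isometric_embedding_exists non_embeddable_family_exists by metis

end
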